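(* Let $\Sigma=\{\alpha,\beta,\gamma,\delta\}$ be an observable co-isometric realization of $F\in\mathcal S(\mathcal U,\mathcal Y)$ with state space $\mathcal X$, and let $M_\Sigma$ be the associated system matrix. Set $\mathcal M_\Sigma=\operatorname{Im}M_\Sigma^*\subset\mathcal U\oplus\mathcal X$. Then $$\sigma_F(u)=\langle P_{\mathcal M_\Sigma^\perp}\tau_{\mathcal U}u,\tau_{\mathcal U}u\rangle\qquad(u\in\mathcal U),$$ where $\tau_{\mathcal U}$ is the embedding operator of $\mathcal U$ into $\mathcal U\oplus\mathcal X$ and $P_{\mathcal M_\Sigma^\perp}$ is the orthogonal projection of $\mathcal U\oplus\mathcal X$ onto $\mathcal M_\Sigma^\perp$.
   Context: All spaces are complex Hilbert spaces and "operator" means bounded linear operator. $\mathbb D$ is the open unit disc. For a Hilbert space $\mathcal V$, $\ell^2_+(\mathcal V)$ is the space of square summable unilateral sequences in $\mathcal V$ and $E_{\mathcal V}:\mathcal V\to\ell^2_+(\mathcal V)$, $E_{\mathcal V}v=(v,0,0,\dots)$. The Schur class $\mathcal S(\mathcal U,\mathcal Y)$ is the set of analytic functions $F$ on $\mathbb D$ with values operators from $\mathcal U$ to $\mathcal Y$ and $\sup_{\lambda\in\mathbb D}\|F(\lambda)\|\le1$; $T_F:\ell^2_+(\mathcal U)\to\ell^2_+(\mathcal Y)$ is the corresponding block lower triangular Toeplitz operator. Entropy: for $F\in\mathcal S(\mathcal U,\mathcal Y)$ and $u\in\mathcal U$, $$\sigma_F(u)=\inf\bigl\{\|u-E_{\mathcal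 U}^*T_F^*h\|^2+\langle(I-T_FT_F^* )h,h\rangle : h\in\ell^2_+(\mathcal Y)\bigr\}.$$ A system $\Sigma=\{\alpha,\beta,\gamma,\delta\}$ consists of operators $\alpha:\mathcal X\to\mathcal X$, $\beta:\mathcal U\to\mathcal X$, $\gamma:\mathcal X\to\mathcal Y$, $\delta:\mathcal U\to\mathcal Y$. It is a realization of $F$ if $F(\lambda)=\delta+\lambda\gamma(I-\lambda\alpha)^{-1}\beta$ for $\lambda$ in a neighborhood of $0$. Its system matrix is $M_\Sigma=\begin{bmatrix}\delta&\gamma\\ \beta&\alpha\end{bmatrix}:\mathcal U\oplus\mathcal X\to\mathcal Y\oplus\mathcal X$. It is co-isometric if $M_\Sigma M_\Sigma^*=I$, and observable if $\bigcap_{n\ge0}\operatorname{Ker}\gamma\alpha^n=\{0\}$. *)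

theory Defs
  imports "HOL-Analysis.Analysis"
begin

text \<open>
  Complex Hilbert spaces. The class extends \<open>real_inner\<close> by a complex scalar
  multiplication and a complex inner product (linear in the first argument) that are compatible
  with the real structure; norm and metric are those of the underlying real Hilbert space, so that
  \<open>cinner x x = (norm x)\<^sup>2\<close>, and the library notions \<open>bounded_linear\<close>, \<open>onorm\<close>, limits and
  sums apply directly.
\<close>

class complex_hilbert = real_inner + complete_space +
  fixes scaleC :: "complex \<Rightarrow> 'a \<Rightarrow> 'a" (infixr "*\<^sub>C" 75)
    and cinner :: "'a \<Rightarrow> 'a \<Rightarrow> complex"
  assumes scaleC_add_right: "a *\<^sub>C (x + y) = a *\<^sub>C x + a *\<^sub>C y"
    and scaleC_add_left: "(a + b) *\<^sub>C x = a *\<^sub>C x + b *\<^sub>C x"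
    and scaleC_scaleC: "a *\<^sub>C b *\<^sub>C x = (a * b) *\<^sub>C x"
    and scaleC_of_real: "complex_of_real r *\<^sub>C x = r *\<^sub>R x"
    and cinner_commute: "cinner x y = cnj (cinner y x)"
    and cinner_add_left: "cinner (x + y) z = cinner x z + cinner y z"
    and cinner_scaleC_left: "cinner (a *\<^sub>C x) y = a * cinner x y"
    and Re_cinner: "Re (cinner x y) = inner x y"

lemma cinner_self: "cinner x x = complex_of_real ((norm x)\<^sup>2)"
proof (rule complex_eqI)
  show "Re (cinner x x) = Re (complex_of_real ((norm x)\<^sup>2))"
    by (simp add: Re_cinner power2_norm_eq_inner)
  have "Im (cinner x x) = - Im (cinner x x)"
    by (subst cinner_commute) simp
  then show "Im (cinner x x) = Im (complex_of_real ((norm x)\<^sup>2))"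
    by simp
qed

lemma norm_scaleC: "norm (a *\<^sub>C x) = cmod a * norm (x :: 'a :: complex_hilbert)"
proof -
  have "cinner (a *\<^sub>C x) (a *\<^sub>C x) = a * cnj (cinner (a *\<^sub>C x) x)"
    unfolding cinner_scaleC_left by (subst cinner_commute) (simp add: cinner_scaleC_left)
  also have "\<dots> = a * cnj a * cinner x x"
    unfolding cinner_scaleC_left complex_cnj_mult mult.assoc
    by (subst (2) cinner_commute) (rule refl)
  finally have "complex_of_real ((norm (a *\<^sub>C x))\<^sup>2) = complex_of_real ((cmod a * norm x)\<^sup>2)"
    by (metis cinner_self complex_norm_square power_mult_distrib of_real_mult of_real_power)
  then have "(norm (a *\<^sub>C x))\<^sup>2 = (cmod a * norm x)\<^sup>2"
    using of_real_eq_iff by blast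
  then show ?thesis
    by simp
qed

lemma norm_cinner_le: "cmod (cinner x y) \<le> norm x * norm (y :: 'a :: complex_hilbert)"
proof (cases "cinner x y = 0")
  case True
  then show ?thesis by simp
next
  case False
  define c where "c = cnj (cinner x y) / complex_of_real (cmod (cinner x y))"
  have c: "cmod c = 1"
    using False by (simp add: c_def norm_divide)
  have "cinner (c *\<^sub>C x) y = complex_of_real (cmod (cinner x y))"
    using False complex_norm_square[of "cinner x y"]
    by (simp add: c_def cinner_scaleC_left divide_eq_eq power2_eq_square mult.commute)
  then have "cmod (cinner x y) = inner (c *\<^sub>C x) y"
    by (metis Re_cinner Re_complex_of_real)
  also have "\<dots> \<le> norm (c *\<^sub>C x) * norm y"
    by (rule norm_cauchy_schwarz)
  finally show ?thesis
    by (simp add: norm_scaleC c)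
qed

instantiation complex :: complex_hilbert
begin

definition scaleC_complex :: "complex \<Rightarrow> complex \<Rightarrow> complex"
  where "scaleC_complex a x = a * x"

definition cinner_complex :: "complex \<Rightarrow> complex \<Rightarrow> complex"
  where "cinner_complex x y = x * cnj y"

instance
  by standard
    (auto simp: scaleC_complex_def cinner_complex_def algebra_simps inner_complex_def
      scaleR_conv_of_real)

end

text \<open>The Hilbert space direct sum; the library norm on pairs is already the Hilbert sum norm.\<close>

instantiation prod :: (complex_hilbert, complex_hilbert) complex_hilbert
begin

definition scaleC_prod :: "complex \<Rightarrow> 'a \<times> 'b \<Rightarrow> 'a \<times> 'b"
  where "scaleC_prod a p = (a *\<^sub>C fst p, a *\<^sub>C snd p)"

definition cinner_prod :: "'a \<times> 'b \<Rightarrow> 'a \<times> 'b \<Rightarrow> complex"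
  where "cinner_prod p q = cinner (fst p) (fst q) + cinner (snd p) (snd q)"

instance
proof
  fix p q r :: "'a \<times> 'b" and a b :: complex and t :: real
  show "cinner p q = cnj (cinner q p)"
    unfolding cinner_prod_def complex_cnj_add
    by (intro arg_cong2[where f = "(+)"] cinner_commute)
qed (auto simp: scaleC_prod_def cinner_prod_def scaleC_add_right scaleC_add_left scaleC_scaleC
      scaleC_of_real cinner_add_left cinner_scaleC_left Re_cinner inner_prod_def scaleR_prod_def
      algebra_simps)

end


subsection \<open>Square summable unilateral sequences\<close>

typedef (overloaded) 'a ell2 =
  "{f :: nat \<Rightarrow> 'a :: real_inner. summable (\<lambda>n. (norm (f n))\<^sup>2)}"
  by (rule exI[of _ "\<lambda>_. 0"]) simp

setup_lifting type_definition_ell2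

lemma summable_Rep_ell2: "summable (\<lambda>n. (norm (Rep_ell2 f n))\<^sup>2)"
  using Rep_ell2[of f] by simp

lemma ell2_summable_norm_mult:
  fixes f g :: "nat \<Rightarrow> 'a :: real_normed_vector"
  assumes "summable (\<lambda>n. (norm (f n))\<^sup>2)" "summable (\<lambda>n. (norm (g n))\<^sup>2)"
  shows "summable (\<lambda>n. norm (f n) * norm (g n))"
proof (rule summable_comparison_test')
  show "summable (\<lambda>n. (norm (f n))\<^sup>2 + (norm (g n))\<^sup>2)"
    using assms by (rule summable_add)
  fix n :: nat
  have "2 * (norm (f n) * norm (g n)) \<le> (norm (f n))\<^sup>2 + (norm (g n))\<^sup>2"
    using sum_squares_bound[of "norm (f n)" "norm (g n)"] by (simp add: mult.assoc)
  moreover have "0 \<le> norm (f n) * norm (g n)"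
    by simp
  ultimately show "norm (norm (f n) * norm (g n)) \<le> (norm (f n))\<^sup>2 + (norm (g n))\<^sup>2"
    unfolding real_norm_def by linarith
qed

lemma ell2_summable_add:
  fixes f g :: "nat \<Rightarrow> 'a :: real_normed_vector"
  assumes "summable (\<lambda>n. (norm (f n))\<^sup>2)" "summable (\<lambda>n. (norm (g n))\<^sup>2)"
  shows "summable (\<lambda>n. (norm (f n + g n))\<^sup>2)"
proof (rule summable_comparison_test')
  show "summable (\<lambda>n. (norm (f n))\<^sup>2 + 2 * (norm (f n) * norm (g n)) + (norm (g n))\<^sup>2)"
    using assms ell2_summable_norm_mult[OF assms]
    by (intro summable_add summable_mult) auto
  fix n :: nat
  have "(norm (f n + g n))\<^sup>2 \<le> (norm (f n) + norm (g n))\<^sup>2"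
    by (intro power_mono norm_triangle_ineq) simp
  then show "norm ((norm (f n + g n))\<^sup>2)
      \<le> (norm (f n))\<^sup>2 + 2 * (norm (f n) * norm (g n)) + (norm (g n))\<^sup>2"
    by (simp add: power2_sum algebra_simps)
qed

lemma ell2_summable_inner:
  "summable (\<lambda>n. inner (Rep_ell2 f n) (Rep_ell2 g n))"
proof (rule summable_comparison_test')
  show "summable (\<lambda>n. norm (Rep_ell2 f n) * norm (Rep_ell2 g n))"
    by (intro ell2_summable_norm_mult summable_Rep_ell2)
  show "norm (inner (Rep_ell2 f n) (Rep_ell2 g n)) \<le> norm (Rep_ell2 f n) * norm (Rep_ell2 g n)" for n
    by (simp add: Cauchy_Schwarz_ineq2)
qed

lemma ell2_summable_cinner:
  fixes f g :: "'a :: complex_hilbert ell2"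
  shows "summable (\<lambda>n. cinner (Rep_ell2 f n) (Rep_ell2 g n))"
proof (rule summable_comparison_test')
  show "summable (\<lambda>n. norm (Rep_ell2 f n) * norm (Rep_ell2 g n))"
    by (intro ell2_summable_norm_mult summable_Rep_ell2)
  show "norm (cinner (Rep_ell2 f n) (Rep_ell2 g n)) \<le> norm (Rep_ell2 f n) * norm (Rep_ell2 g n)" for n
    by (rule norm_cinner_le)
qed

instantiation ell2 :: (real_inner) real_vector
begin

lift_definition zero_ell2 :: "'a ell2" is "\<lambda>_. 0"
  by simp

lift_definition plus_ell2 :: "'a ell2 \<Rightarrow> 'a ell2 \<Rightarrow> 'a ell2" is "\<lambda>f g n. f n + g n"
  by (rule ell2_summable_add)

lift_definition uminus_ell2 :: "'a ell2 \<Rightarrow> 'a ell2" is "\<lambda>f n. - f n"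
  by simp

lift_definition scaleR_ell2 :: "real \<Rightarrow> 'a ell2 \<Rightarrow> 'a ell2" is "\<lambda>r f n. r *\<^sub>R f n"
  by (simp add: power_mult_distrib summable_mult)

definition minus_ell2 :: "'a ell2 \<Rightarrow> 'a ell2 \<Rightarrow> 'a ell2"
  where "minus_ell2 f g = f + - g"

instance
proof
  fix f g h :: "'a ell2" and r s :: real
  show "f + g + h = f + (g + h)" by transfer (simp add: add.assoc)
  show "f + g = g + f" by transfer (simp add: add.commute)
  show "0 + f = f" by transfer simp
  show "- f + f = 0" by transfer simp
  show "f - g = f + - g" by (simp add: minus_ell2_def)
  show "r *\<^sub>R (f + g) = r *\<^sub>R f + r *\<^sub>R g" by transfer (simp add: scaleR_add_right)
  show "(r + s) *\<^sub>R f = r *\<^sub>R f + s *\<^sub>R f" by transfer (simp add: scaleR_add_left)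
  show "r *\<^sub>R s *\<^sub>R f = (r * s) *\<^sub>R f" by transfer simp
  show "1 *\<^sub>R f = f" by transfer simp
qed

end

instantiation ell2 :: (real_inner) real_inner
begin

definition inner_ell2 :: "'a ell2 \<Rightarrow> 'a ell2 \<Rightarrow> real"
  where "inner_ell2 f g = (\<Sum>n. inner (Rep_ell2 f n) (Rep_ell2 g n))"

definition norm_ell2 :: "'a ell2 \<Rightarrow> real"
  where "norm_ell2 f = sqrt (inner f f)"

definition sgn_ell2 :: "'a ell2 \<Rightarrow> 'a ell2"
  where "sgn_ell2 f = inverse (norm f) *\<^sub>R f"

definition dist_ell2 :: "'a ell2 \<Rightarrow> 'a ell2 \<Rightarrow> real"
  where "dist_ell2 f g = norm (f - g)"

definition uniformity_ell2 :: "('a ell2 \<times> 'a ell2) filter"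
  where "uniformity_ell2 = (INF e\<in>{0<..}. principal {(x, y). dist x y < e})"

definition open_ell2 :: "'a ell2 set \<Rightarrow> bool"
  where "open_ell2 U \<longleftrightarrow> (\<forall>x\<in>U. eventually (\<lambda>(x', y). x' = x \<longrightarrow> y \<in> U) uniformity)"

instance
proof
  fix f g h :: "'a ell2" and r s :: real
  show "dist f g = norm (f - g)" by (simp add: dist_ell2_def)
  show "sgn f = f /\<^sub>R norm f" by (simp add: sgn_ell2_def)
  show "uniformity = (INF e\<in>{0<..}. principal {(x :: 'a ell2, y). dist x y < e})"
    by (rule uniformity_ell2_def)
  show "open U \<longleftrightarrow> (\<forall>x\<in>U. \<forall>\<^sub>F (x', y) in uniformity. x' = x \<longrightarrow> y \<in> U)" for U :: "'a ell2 set"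
    by (rule open_ell2_def)
  show "inner f g = inner g f" by (simp add: inner_ell2_def inner_commute)
  show "inner (f + g) h = inner f h + inner g h"
    unfolding inner_ell2_def plus_ell2.rep_eq inner_add_left
    by (rule suminf_add[symmetric]) (rule ell2_summable_inner)+
  show "inner (r *\<^sub>R f) g = r * inner f g"
    unfolding inner_ell2_def scaleR_ell2.rep_eq inner_scaleR_left
    by (rule suminf_mult) (rule ell2_summable_inner)
  show "0 \<le> inner f f"
    unfolding inner_ell2_def by (intro suminf_nonneg ell2_summable_inner) simp
  show "inner f f = 0 \<longleftrightarrow> f = 0"
  proof -
    have "inner f f = 0 \<longleftrightarrow> (\<forall>n. inner (Rep_ell2 f n) (Rep_ell2 f n) = 0)"
      unfolding inner_ell2_def by (intro suminf_eq_zero_iff ell2_summable_inner) simp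
    also have "\<dots> \<longleftrightarrow> f = 0"
      by (simp add: zero_ell2.rep_eq fun_eq_iff flip: Rep_ell2_inject)
    finally show ?thesis .
  qed
  show "norm f = sqrt (inner f f)" by (simp add: norm_ell2_def)
qed

end

lemma norm_ell2_power2: "(norm f)\<^sup>2 = (\<Sum>n. (norm (Rep_ell2 f n))\<^sup>2)"
  by (simp add: power2_norm_eq_inner inner_ell2_def)

lemma minus_ell2_rep_eq: "Rep_ell2 (f - g) n = Rep_ell2 f n - Rep_ell2 g n"
  unfolding minus_ell2_def plus_ell2.rep_eq uminus_ell2.rep_eq by simp

lemma ell2_partial_sum_le: "(\<Sum>n<K. (norm (Rep_ell2 f n))\<^sup>2) \<le> (norm f)\<^sup>2"
  unfolding norm_ell2_power2 by (intro sum_le_suminf summable_Rep_ell2) auto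

lemma norm_Rep_ell2_le: "norm (Rep_ell2 f n) \<le> norm f"
proof (rule power2_le_imp_le)
  have "(norm (Rep_ell2 f n))\<^sup>2 \<le> (\<Sum>k<Suc n. (norm (Rep_ell2 f k))\<^sup>2)"
    by (rule member_le_sum) auto
  also have "\<dots> \<le> (norm f)\<^sup>2"
    by (rule ell2_partial_sum_le)
  finally show "(norm (Rep_ell2 f n))\<^sup>2 \<le> (norm f)\<^sup>2" .
qed simp

instance ell2 :: ("{real_inner, complete_space}") complete_space
proof
  fix X :: "nat \<Rightarrow> 'a ell2"
  assume X: "Cauchy X"
  have "Cauchy (\<lambda>k. Rep_ell2 (X k) n)" for n
  proof (rule metric_CauchyI)
    fix e :: real assume "0 < e"
    with X obtain N where N: "\<And>i j. i \<ge> N \<Longrightarrow> j \<ge> N \<Longrightarrow> dist (X i) (X j) < e"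
      unfolding Cauchy_def by blast
    have "dist (Rep_ell2 (X i) n) (Rep_ell2 (X j) n) < e" if "i \<ge> N" "j \<ge> N" for i j
      using N[OF that] norm_Rep_ell2_le[of "X i - X j" n]
      by (simp add: dist_norm minus_ell2_rep_eq)
    then show "\<exists>N. \<forall>i\<ge>N. \<forall>j\<ge>N. dist (Rep_ell2 (X i) n) (Rep_ell2 (X j) n) < e"
      by blast
  qed
  then have "\<exists>l. (\<lambda>k. Rep_ell2 (X k) n) \<longlonglongrightarrow> l" for n
    unfolding convergent_def[symmetric] by (rule Cauchy_convergent)
  then obtain l where l: "\<And>n. (\<lambda>k. Rep_ell2 (X k) n) \<longlonglongrightarrow> l n"
    by metis
  have *: "\<exists>N. \<forall>i\<ge>N. \<forall>K. (\<Sum>n<K. (norm (Rep_ell2 (X i) n - l n))\<^sup>2) \<le> e\<^sup>2" if "0 < e" for e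
  proof -
    obtain N where N: "\<And>i j. i \<ge> N \<Longrightarrow> j \<ge> N \<Longrightarrow> dist (X i) (X j) < e"
      using X \<open>0 < e\<close> unfolding Cauchy_def by blast
    have "(\<Sum>n<K. (norm (Rep_ell2 (X i) n - l n))\<^sup>2) \<le> e\<^sup>2" if i: "i \<ge> N" for i K
    proof (rule tendsto_upperbound)
      show "(\<lambda>j. \<Sum>n<K. (norm (Rep_ell2 (X i) n - Rep_ell2 (X j) n))\<^sup>2)
          \<longlonglongrightarrow> (\<Sum>n<K. (norm (Rep_ell2 (X i) n - l n))\<^sup>2)"
        by (intro tendsto_intros l)
      show "\<forall>\<^sub>F j in sequentially. (\<Sum>n<K. (norm (Rep_ell2 (X i) n - Rep_ell2 (X j) n))\<^sup>2) \<le> e\<^sup>2"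
        unfolding eventually_sequentially
      proof (intro exI allI impI)
        fix j assume j: "N \<le> j"
        have "(\<Sum>n<K. (norm (Rep_ell2 (X i) n - Rep_ell2 (X j) n))\<^sup>2) \<le> (norm (X i - X j))\<^sup>2"
          using ell2_partial_sum_le[of "X i - X j" K] by (simp add: minus_ell2_rep_eq)
        also have "\<dots> \<le> e\<^sup>2"
          using N[OF i j] by (intro power_mono) (auto simp: dist_norm)
        finally show "(\<Sum>n<K. (norm (Rep_ell2 (X i) n - Rep_ell2 (X j) n))\<^sup>2) \<le> e\<^sup>2" .
      qed
    qed simp
    then show ?thesis by blast
  qed
  have diff: "summable (\<lambda>n. (norm (Rep_ell2 (X i) n - l n))\<^sup>2)"
    if "\<forall>K. (\<Sum>n<K. (norm (Rep_ell2 (X i) n - l n))\<^sup>2) \<le> e\<^sup>2" for i e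
    using that by (intro bounded_imp_summable[where B = "e\<^sup>2"])
      (auto simp flip: lessThan_Suc_atMost simp del: sum.lessThan_Suc)
  obtain N where "\<forall>i\<ge>N. \<forall>K. (\<Sum>n<K. (norm (Rep_ell2 (X i) n - l n))\<^sup>2) \<le> 1\<^sup>2"
    using *[of 1] by auto
  then have "summable (\<lambda>n. (norm (- (Rep_ell2 (X N) n - l n)))\<^sup>2)"
    unfolding norm_minus_cancel using diff by blast
  from ell2_summable_add[OF this summable_Rep_ell2[of "X N"]]
  have l_summable: "summable (\<lambda>n. (norm (l n))\<^sup>2)"
    by simp
  define L where "L = Abs_ell2 l"
  have L: "Rep_ell2 L = l"
    unfolding L_def using l_summable by (simp add: Abs_ell2_inverse)
  have "X \<longlonglongrightarrow> L"
  proof (rule metric_LIMSEQ_I)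
    fix r :: real assume "0 < r"
    then have "0 < r / 2" by simp
    from *[OF this] obtain N
      where N: "\<And>i K. i \<ge> N \<Longrightarrow> (\<Sum>n<K. (norm (Rep_ell2 (X i) n - l n))\<^sup>2) \<le> (r / 2)\<^sup>2"
      by blast
    have "dist (X i) L < r" if "i \<ge> N" for i
    proof -
      have "(norm (X i - L))\<^sup>2 \<le> (r / 2)\<^sup>2"
        unfolding norm_ell2_power2
        by (intro suminf_le_const summable_Rep_ell2) (use N[OF that] in \<open>simp add: minus_ell2_rep_eq L\<close>)
      then have "norm (X i - L) \<le> r / 2"
        by (rule power2_le_imp_le) (use \<open>0 < r\<close> in simp)
      then show ?thesis
        using \<open>0 < r\<close> by (simp add: dist_norm)
    qed
    then show "\<exists>N. \<forall>i\<ge>N. dist (X i) L < r" by blast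
  qed
  then show "convergent X"
    by (auto simp: convergent_def)
qed

instantiation ell2 :: (complex_hilbert) complex_hilbert
begin

lift_definition scaleC_ell2 :: "complex \<Rightarrow> 'a ell2 \<Rightarrow> 'a ell2" is "\<lambda>a f n. a *\<^sub>C f n"
  by (simp add: norm_scaleC power_mult_distrib summable_mult)

definition cinner_ell2 :: "'a ell2 \<Rightarrow> 'a ell2 \<Rightarrow> complex"
  where "cinner_ell2 f g = (\<Sum>n. cinner (Rep_ell2 f n) (Rep_ell2 g n))"

instance
proof
  fix f g h :: "'a ell2" and a b :: complex and r :: real
  show "a *\<^sub>C (f + g) = a *\<^sub>C f + a *\<^sub>C g" by transfer (simp add: scaleC_add_right)
  show "(a + b) *\<^sub>C f = a *\<^sub>C f + b *\<^sub>C f" by transfer (simp add: scaleC_add_left)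
  show "a *\<^sub>C b *\<^sub>C f = (a * b) *\<^sub>C f" by transfer (simp add: scaleC_scaleC)
  show "complex_of_real r *\<^sub>C f = r *\<^sub>R f" by transfer (simp add: scaleC_of_real)
  show "cinner f g = cnj (cinner g f)"
  proof -
    have "(\<lambda>n. cnj (cinner (Rep_ell2 g n) (Rep_ell2 f n))) sums cnj (cinner g f)"
      unfolding cinner_ell2_def sums_cnj by (rule summable_sums, rule ell2_summable_cinner)
    moreover have "(\<lambda>n. cnj (cinner (Rep_ell2 g n) (Rep_ell2 f n)))
        = (\<lambda>n. cinner (Rep_ell2 f n) (Rep_ell2 g n))"
      by (rule ext) (rule cinner_commute[symmetric])
    ultimately show ?thesis
      unfolding cinner_ell2_def[of f g] by (simp only: sums_iff)
  qed
  show "cinner (f + g) h = cinner f h + cinner g h"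
    unfolding cinner_ell2_def plus_ell2.rep_eq cinner_add_left
    by (rule suminf_add[symmetric]) (rule ell2_summable_cinner)+
  show "cinner (a *\<^sub>C f) g = a * cinner f g"
    unfolding cinner_ell2_def scaleC_ell2.rep_eq cinner_scaleC_left
    by (rule suminf_mult) (rule ell2_summable_cinner)
  show "Re (cinner f g) = inner f g"
    unfolding cinner_ell2_def inner_ell2_def
    by (simp add: Re_suminf ell2_summable_cinner Re_cinner)
qed

end


subsection \<open>Operators\<close>

definition bounded_clinear :: "('a :: complex_hilbert \<Rightarrow> 'b :: complex_hilbert) \<Rightarrow> bool"
  where "bounded_clinear T \<longleftrightarrow> bounded_linear T \<and> (\<forall>a x. T (a *\<^sub>C x) = a *\<^sub>C T x)"

text \<open>Well defined whenever \<open>T\<close> is \<open>bounded_clinear\<close>.\<close>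

definition adjoint_op ::
    "('a :: complex_hilbert \<Rightarrow> 'b :: complex_hilbert) \<Rightarrow> 'b \<Rightarrow> 'a"
  where "adjoint_op T = (THE S. \<forall>x y. cinner (T x) y = cinner x (S y))"

definition orth_compl :: "'a :: complex_hilbert set \<Rightarrow> 'a set"
  where "orth_compl S = {x. \<forall>y\<in>S. cinner x y = 0}"

text \<open>Orthogonal projection onto a closed subspace \<open>S\<close>.\<close>

definition orth_proj :: "'a :: complex_hilbert set \<Rightarrow> 'a \<Rightarrow> 'a"
  where "orth_proj S x = (THE p. p \<in> S \<and> x - p \<in> orth_compl S)"


subsection \<open>Schur class and Toeplitz operators\<close>

text \<open>Analyticity of an operator valued function: complex differentiability in operator norm.\<close>

definition op_analytic_on ::
    "(complex \<Rightarrow> 'u :: complex_hilbert \<Rightarrow> 'y :: complex_hilbert) \<Rightarrow> complex set \<Rightarrow> bool"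
  where "op_analytic_on F S \<longleftrightarrow>
    (\<forall>z\<in>S. \<exists>D. bounded_clinear D \<and>
      ((\<lambda>w. onorm (\<lambda>u. inverse (w - z) *\<^sub>C (F w u - F z u) - D u)) \<longlongrightarrow> 0) (at z within S))"

text \<open>The values of \<open>F\<close> outside the open unit disc are irrelevant.\<close>

definition schur_class ::
    "(complex \<Rightarrow> 'u :: complex_hilbert \<Rightarrow> 'y :: complex_hilbert) set"
  where "schur_class = {F. (\<forall>z\<in>ball 0 1. bounded_clinear (F z)) \<and>
    op_analytic_on F (ball 0 1) \<and> (\<forall>z\<in>ball 0 1. onorm (F z) \<le> 1)}"

definition taylor_coeff ::
    "(complex \<Rightarrow> 'u :: complex_hilbert \<Rightarrow> 'y :: complex_hilbert) \<Rightarrow> nat \<Rightarrow> 'u \<Rightarrow> 'y"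
  where "taylor_coeff F = (THE c. (\<forall>n. bounded_clinear (c n)) \<and>
    (\<forall>z\<in>ball 0 1. \<forall>u. (\<lambda>n. z ^ n *\<^sub>C c n u) sums F z u))"

text \<open>For \<open>F\<close> in the Schur class the sequence below is square summable (the operator is a
  contraction), so \<open>Abs_ell2\<close> is applied inside its domain.\<close>

definition toeplitz ::
    "(complex \<Rightarrow> 'u :: complex_hilbert \<Rightarrow> 'y :: complex_hilbert) \<Rightarrow> 'u ell2 \<Rightarrow> 'y ell2"
  where "toeplitz F h = Abs_ell2 (\<lambda>n. \<Sum>k\<le>n. taylor_coeff F (n - k) (Rep_ell2 h k))"

definition ell2_embed :: "'v :: complex_hilbert \<Rightarrow> 'v ell2"
  where "ell2_embed v = Abs_ell2 (\<lambda>n. if n = 0 then v else 0)"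

text \<open>\<open>I - T\<^sub>F T\<^sub>F\<^sup>*\<close> is selfadjoint, so taking the real part loses nothing.\<close>

definition entropy ::
    "(complex \<Rightarrow> 'u :: complex_hilbert \<Rightarrow> 'y :: complex_hilbert) \<Rightarrow> 'u \<Rightarrow> real"
  where "entropy F u = (INF h. (norm (u - adjoint_op ell2_embed (adjoint_op (toeplitz F) h)))\<^sup>2
    + Re (cinner (h - toeplitz F (adjoint_op (toeplitz F) h)) h))"


subsection \<open>Systems\<close>

definition system_ops ::
    "('x :: complex_hilbert \<Rightarrow> 'x) \<Rightarrow> ('u :: complex_hilbert \<Rightarrow> 'x) \<Rightarrow>
      ('x \<Rightarrow> 'y :: complex_hilbert) \<Rightarrow> ('u \<Rightarrow> 'y) \<Rightarrow> bool"
  where "system_ops \<alpha> \<beta> \<gamma> \<delta> \<longleftrightarrow>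
    bounded_clinear \<alpha> \<and> bounded_clinear \<beta> \<and> bounded_clinear \<gamma> \<and> bounded_clinear \<delta>"

text \<open>Near \<open>0\<close> the operator \<open>I - \<lambda> \<alpha>\<close> is bijective, and \<open>inv\<close> is its inverse operator.\<close>

definition realization ::
    "('x :: complex_hilbert \<Rightarrow> 'x) \<Rightarrow> ('u :: complex_hilbert \<Rightarrow> 'x) \<Rightarrow>
      ('x \<Rightarrow> 'y :: complex_hilbert) \<Rightarrow> ('u \<Rightarrow> 'y) \<Rightarrow> (complex \<Rightarrow> 'u \<Rightarrow> 'y) \<Rightarrow> bool"
  where "realization \<alpha> \<beta> \<gamma> \<delta> F \<longleftrightarrow>
    (\<forall>\<^sub>F z in nhds 0. \<forall>u. F z u = \<delta> u + z *\<^sub>C \<gamma> (inv (\<lambda>x. x - z *\<^sub>C \<alpha> x) (\<beta> u)))"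

definition system_matrix ::
    "('x :: complex_hilbert \<Rightarrow> 'x) \<Rightarrow> ('u :: complex_hilbert \<Rightarrow> 'x) \<Rightarrow>
      ('x \<Rightarrow> 'y :: complex_hilbert) \<Rightarrow> ('u \<Rightarrow> 'y) \<Rightarrow> 'u \<times> 'x \<Rightarrow> 'y \<times> 'x"
  where "system_matrix \<alpha> \<beta> \<gamma> \<delta> = (\<lambda>(u, x). (\<delta> u + \<gamma> x, \<beta> u + \<alpha> x))"

definition co_isometric ::
    "('x :: complex_hilbert \<Rightarrow> 'x) \<Rightarrow> ('u :: complex_hilbert \<Rightarrow> 'x) \<Rightarrow>
      ('x \<Rightarrow> 'y :: complex_hilbert) \<Rightarrow> ('u \<Rightarrow> 'y) \<Rightarrow> bool"
  where "co_isometric \<alpha> \<beta> \<gamma> \<delta> \<longleftrightarrow>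
    system_matrix \<alpha> \<beta> \<gamma> \<delta> \<circ> adjoint_op (system_matrix \<alpha> \<beta> \<gamma> \<delta>) = id"

definition observable ::
    "('x :: complex_hilbert \<Rightarrow> 'x) \<Rightarrow> ('x \<Rightarrow> 'y :: complex_hilbert) \<Rightarrow> bool"
  where "observable \<alpha> \<gamma> \<longleftrightarrow> (\<Inter>n. {x. \<gamma> ((\<alpha> ^^ n) x) = 0}) = {0}"

definition embed_input :: "'u :: complex_hilbert \<Rightarrow> 'u \<times> 'x :: complex_hilbert"
  where "embed_input u = (u, 0)"

end

theory Submission
  imports Defs "HOL-Complex_Analysis.Conformal_Mappings"
begin

text \<open>
  Let \<open>W x = (\<gamma> \<alpha>\<^sup>n x)\<^sub>n\<close> be the observability operator and \<open>T\<close> the Toeplitz operator of \<open>F\<close>; both are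
  contractions because the system matrix \<open>M\<close> is one. For \<open>h = (h\<^sub>0, h')\<close> the state space formulas give
  \<open>M\<^sup>* (h\<^sub>0, W\<^sup>* h') = (E\<^sup>* T\<^sup>* h, W\<^sup>* h)\<close>, and since \<open>M\<^sup>*\<close> is isometric, iterating this along the tails
  of \<open>h\<close> yields \<open>I - T T\<^sup>* = W W\<^sup>*\<close>. Hence the functional minimised in the entropy is
  \<open>\<parallel>(u, 0) - M\<^sup>* (h\<^sub>0, W\<^sup>* h')\<parallel>\<^sup>2\<close>. Observability makes the range of \<open>W\<^sup>*\<close> dense, so the infimum is the
  squared distance of \<open>(u, 0)\<close> to the closed range of \<open>M\<^sup>*\<close>.
\<close>

text \<open>Gives access to absolutely convergent series of vectors, as in
  \<open>neumann_series\<close>.\<close>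

instance complex_hilbert \<subseteq> banach ..

subsection \<open>Complex Hilbert spaces\<close>

lemma cinner_diff_left: "cinner (x - y) z = cinner x z - cinner y (z :: 'a :: complex_hilbert)"
  using cinner_add_left[of "x - y" y z] by simp

lemma cinner_zero_left [simp]: "cinner 0 (z :: 'a :: complex_hilbert) = 0"
  using cinner_diff_left[of 0 0 z] by simp

lemma cinner_add_right: "cinner z (x + y) = cinner z x + cinner z (y :: 'a :: complex_hilbert)"
  by (metis cinner_add_left cinner_commute complex_cnj_add)

lemma cinner_diff_right: "cinner z (x - y) = cinner z x - cinner z (y :: 'a :: complex_hilbert)"
  by (metis cinner_diff_left cinner_commute complex_cnj_diff)

lemma cinner_zero_right [simp]: "cinner (z :: 'a :: complex_hilbert) 0 = 0"
  using cinner_diff_right[of z 0 0] by simp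

lemma cinner_scaleC_right: "cinner x (a *\<^sub>C y) = cnj a * cinner x (y :: 'a :: complex_hilbert)"
  by (metis cinner_scaleC_left cinner_commute complex_cnj_mult)

lemma cinner_scaleR_left: "cinner (r *\<^sub>R x) y = r * cinner x (y :: 'a :: complex_hilbert)"
  by (simp add: cinner_scaleC_left flip: scaleC_of_real)

lemma cinner_ext_right:
  fixes a b :: "'a :: complex_hilbert"
  assumes "\<And>x. cinner x a = cinner x b"
  shows "a = b"
proof -
  have "cinner (a - b) (a - b) = 0"
    using assms[of "a - b"] by (simp add: cinner_diff_right)
  then show ?thesis
    by (simp add: cinner_self)
qed

lemma cinner_ext_left:
  fixes a b :: "'a :: complex_hilbert"
  assumes "\<And>x. cinner a x = cinner b x"
  shows "a = b"
  by (rule cinner_ext_right) (metis assms cinner_commute)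

lemma bounded_linear_cinner_left:
  "bounded_linear (\<lambda>x :: 'a :: complex_hilbert. cinner x y)"
proof (rule bounded_linear_intro)
  show "cinner (r *\<^sub>R x) y = r *\<^sub>R cinner x y" for r and x :: 'a
    by (simp add: cinner_scaleR_left scaleR_conv_of_real)
qed (use norm_cinner_le in \<open>auto simp: cinner_add_left\<close>)

lemma norm_diff_square:
  "(norm (x - y))\<^sup>2 = (norm x)\<^sup>2 - 2 * Re (cinner x y) + (norm (y :: 'a :: complex_hilbert))\<^sup>2"
  unfolding power2_norm_eq_inner Re_cinner
  by (simp add: inner_diff_left inner_diff_right inner_commute[of y x])

lemma scaleC_diff_right: "a *\<^sub>C (x - y) = a *\<^sub>C x - a *\<^sub>C (y :: 'a :: complex_hilbert)"
  using scaleC_add_right[of a "x - y" y] by simp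

lemma scaleC_zero_right [simp]: "a *\<^sub>C 0 = (0 :: 'a :: complex_hilbert)"
  using scaleC_diff_right[of a 0 0] by simp

lemma scaleC_one [simp]: "1 *\<^sub>C x = (x :: 'a :: complex_hilbert)"
  using scaleC_of_real[of 1 x] by simp

lemma bounded_linear_scaleC: "bounded_linear (\<lambda>x :: 'a :: complex_hilbert. a *\<^sub>C x)"
proof (rule bounded_linear_intro)
  show "a *\<^sub>C (r *\<^sub>R x) = r *\<^sub>R (a *\<^sub>C x)" for r and x :: 'a
    by (simp add: scaleC_scaleC mult.commute flip: scaleC_of_real)
  show "norm (a *\<^sub>C x) \<le> norm x * cmod a" for x :: 'a
    by (simp add: norm_scaleC)
qed (simp add: scaleC_add_right)

section \<open>Bounded complex linear maps; nearest points in closures of subspaces\<close>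

lemma bounded_clinearI:
  fixes T :: "'a :: complex_hilbert \<Rightarrow> 'b :: complex_hilbert"
  assumes "\<And>x y. T (x + y) = T x + T y" "\<And>a x. T (a *\<^sub>C x) = a *\<^sub>C T x"
    and "\<And>x. norm (T x) \<le> norm x * K"
  shows "bounded_clinear T"
  unfolding bounded_clinear_def
proof (intro conjI allI)
  show "bounded_linear T"
    by (rule bounded_linear_intro[where K = K]) (use assms in \<open>auto simp flip: scaleC_of_real\<close>)
qed (use assms in auto)

lemma bounded_clinear_imp_bounded_linear: "bounded_clinear T \<Longrightarrow> bounded_linear T"
  by (simp add: bounded_clinear_def)

lemma bounded_clinear_scaleC: "bounded_clinear T \<Longrightarrow> T (a *\<^sub>C x) = a *\<^sub>C T x"
  by (simp add: bounded_clinear_def)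

lemma bounded_clinear_compose:
  "bounded_clinear S \<Longrightarrow> bounded_clinear T \<Longrightarrow> bounded_clinear (\<lambda>x. S (T x))"
  unfolding bounded_clinear_def using bounded_linear_compose by auto

lemma bounded_clinear_funpow:
  fixes T :: "'a :: complex_hilbert \<Rightarrow> 'a"
  assumes "bounded_clinear T"
  shows "bounded_clinear (T ^^ n)"
proof (induction n)
  case 0
  then show ?case
    by (simp add: bounded_clinear_def id_def bounded_linear_ident)
next
  case (Suc n)
  then show ?case
    using bounded_clinear_compose[OF assms Suc] by (simp add: comp_def)
qed

text \<open>Minimising sequences in a subspace are Cauchy by the parallelogram identity.\<close>

lemma subspace_closure_orthogonal_projection:
  fixes S :: "'a :: {real_inner, complete_space} set"
  assumes S: "subspace S"
  obtains p where "p \<in> closure S" "\<And>y. y \<in> S \<Longrightarrow> inner (x - p) y = 0"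
proof -
  define d where "d = infdist x S"
  have ne: "S \<noteq> {}"
    using subspace_0[OF S] by auto
  have d0: "0 \<le> d"
    unfolding d_def by (rule infdist_nonneg)
  have d_le: "d\<^sup>2 \<le> (norm (x - y))\<^sup>2" if "y \<in> S" for y
    using infdist_le[OF that, of x] d0 by (intro power_mono) (auto simp: d_def dist_norm)
  have "\<exists>y\<in>S. (norm (x - y))\<^sup>2 < d\<^sup>2 + inverse (real (Suc n))" for n
  proof -
    have "d < sqrt (d\<^sup>2 + inverse (real (Suc n)))"
      by (rule real_less_rsqrt) simp
    then have "\<exists>y\<in>S. dist x y < sqrt (d\<^sup>2 + inverse (real (Suc n)))"
      unfolding d_def infdist_notempty[OF ne] by (subst (asm) cINF_less_iff) (use ne in auto)
    then obtain y where "y \<in> S" and y: "norm (x - y) < sqrt (d\<^sup>2 + inverse (real (Suc n)))"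
      by (auto simp: dist_norm)
    have "(norm (x - y))\<^sup>2 < (sqrt (d\<^sup>2 + inverse (real (Suc n))))\<^sup>2"
      using y by (intro power_strict_mono) auto
    then show ?thesis
      using \<open>y \<in> S\<close> by auto
  qed
  then obtain Y where YS: "\<And>n. Y n \<in> S"
    and Y: "\<And>n. (norm (x - Y n))\<^sup>2 < d\<^sup>2 + inverse (real (Suc n))"
    by metis
  have bound: "(norm (Y m - Y n))\<^sup>2 < 2 * inverse (real (Suc m)) + 2 * inverse (real (Suc n))" for m n
  proof -
    have "(1/2) *\<^sub>R (Y m + Y n) \<in> S"
      using S YS by (simp add: subspace_add subspace_scale)
    from d_le[OF this] have "d\<^sup>2 \<le> (norm (x - (1/2) *\<^sub>R (Y m + Y n)))\<^sup>2" .
    moreover have "(norm (Y m - Y n))\<^sup>2 = 2 * (norm (x - Y m))\<^sup>2 + 2 * (norm (x - Y n))\<^sup>2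
        - 4 * (norm (x - (1/2) *\<^sub>R (Y m + Y n)))\<^sup>2"
      by (simp add: power2_norm_eq_inner inner_diff_left inner_diff_right inner_add_left
          inner_add_right inner_commute algebra_simps)
    ultimately show ?thesis
      using Y[of m] Y[of n] by linarith
  qed
  have "Cauchy Y"
  proof (rule CauchyI)
    fix e :: real assume e: "0 < e"
    then obtain N where N: "inverse (real (Suc N)) < e\<^sup>2 / 4"
      using reals_Archimedean[of "e\<^sup>2 / 4"] by auto
    have "norm (Y m - Y n) < e" if "m \<ge> N" "n \<ge> N" for m n
    proof (rule power2_less_imp_less)
      have "inverse (real (Suc m)) \<le> inverse (real (Suc N))"
        "inverse (real (Suc n)) \<le> inverse (real (Suc N))"
        using that by (simp_all add: le_imp_inverse_le)
      then show "(norm (Y m - Y n))\<^sup>2 < e\<^sup>2"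
        using bound[of m n] N by linarith
    qed (use e in simp)
    then show "\<exists>M. \<forall>m\<ge>M. \<forall>n\<ge>M. norm (Y m - Y n) < e"
      by blast
  qed
  then obtain p where p: "Y \<longlonglongrightarrow> p"
    using Cauchy_convergent_iff convergent_def by blast
  have p_le: "(norm (x - p))\<^sup>2 \<le> d\<^sup>2"
  proof (rule LIMSEQ_le)
    show "(\<lambda>n. (norm (x - Y n))\<^sup>2) \<longlonglongrightarrow> (norm (x - p))\<^sup>2"
      by (intro tendsto_intros p)
    have "(\<lambda>n. d\<^sup>2 + inverse (real (Suc n))) \<longlonglongrightarrow> d\<^sup>2 + 0"
      by (intro tendsto_add tendsto_const LIMSEQ_inverse_real_of_nat)
    then show "(\<lambda>n. d\<^sup>2 + inverse (real (Suc n))) \<longlonglongrightarrow> d\<^sup>2"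
      by simp
    show "\<exists>N. \<forall>n\<ge>N. (norm (x - Y n))\<^sup>2 \<le> d\<^sup>2 + inverse (real (Suc n))"
      using Y by (auto intro: less_imp_le)
  qed
  have orth: "inner (x - p) y = 0" if y: "y \<in> S" for y
  proof (cases "y = 0")
    case False
    \<comment> \<open>The minimiser of the quadratic polynomial
      \<open>t \<mapsto> (norm (x - (p + t *\<^sub>R y)))\<^sup>2\<close>. Its minimum would drop
      below \<open>d\<^sup>2\<close> unless \<open>inner (x - p) y = 0\<close>.\<close>
    define t where "t = inner (x - p) y / inner y y"
    have yy: "0 < inner y y"
      using False by simp
    have "d\<^sup>2 \<le> (norm (x - (p + t *\<^sub>R y)))\<^sup>2"
    \<comment> \<open>The point \<open>p\<close> is only known as a limit of points of
      \<open>S\<close>, so the bound \<open>d_le\<close> is applied to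
      \<open>Y n + t *\<^sub>R y\<close> and passed to the limit.\<close>
    proof (rule tendsto_lowerbound)
      show "(\<lambda>n. (norm (x - (Y n + t *\<^sub>R y)))\<^sup>2) \<longlonglongrightarrow> (norm (x - (p + t *\<^sub>R y)))\<^sup>2"
        by (intro tendsto_intros p)
      show "\<forall>\<^sub>F n in sequentially. d\<^sup>2 \<le> (norm (x - (Y n + t *\<^sub>R y)))\<^sup>2"
        using S YS y by (intro always_eventually allI d_le) (simp add: subspace_add subspace_scale)
    qed simp
    also have "\<dots> = (norm (x - p))\<^sup>2 - 2 * t * inner (x - p) y + t\<^sup>2 * inner y y"
      unfolding power2_norm_eq_inner
      by (simp add: inner_diff_left inner_diff_right inner_add_left inner_add_right inner_commute
          algebra_simps power2_eq_square)
    also have "\<dots> = (norm (x - p))\<^sup>2 - (inner (x - p) y)\<^sup>2 / inner y y"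
    proof -
      have "t * inner y y = inner (x - p) y"
        using yy by (simp add: t_def)
      then have "t\<^sup>2 * inner y y = t * inner (x - p) y"
        by (simp add: power2_eq_square mult.assoc)
      moreover have "(inner (x - p) y)\<^sup>2 / inner y y = t * inner (x - p) y"
        by (simp add: t_def power2_eq_square)
      ultimately show ?thesis
        by linarith
    qed
    finally have "(inner (x - p) y)\<^sup>2 / inner y y \<le> 0"
      using p_le by linarith
    then show ?thesis
      using yy by (simp add: divide_le_0_iff)
  qed simp
  have "p \<in> closure S"
    using p YS closure_sequential by blast
  with orth show thesis
    using that by blast
qed

section \<open>Riesz representation, adjoints and projections\<close>

text \<open>The kernel of a nonzero functional has codimension one, so its orthogonal complement is
  spanned by the component \<open>q\<close> of any \<open>w\<close> with
  \<open>f w \<noteq> 0\<close>. A multiple of \<open>q\<close> represents \<open>f\<close>.\<close>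

lemma riesz_representation:
  fixes f :: "'a :: {real_inner, complete_space} \<Rightarrow> real"
  assumes f: "bounded_linear f"
  obtains z where "\<And>x. f x = inner x z"
proof (cases "\<forall>x. f x = 0")
  case True
  then show ?thesis
    using that[of 0] by simp
next
  case False
  then obtain w where w: "f w \<noteq> 0"
    by blast
  interpret f: bounded_linear f by fact
  define K where "K = {x. f x = 0}"
  have K: "subspace K"
    by (auto simp: K_def subspace_def f.zero f.add f.scaleR)
  have "closed K"
    unfolding K_def by (intro closed_Collect_eq continuous_intros f.continuous_on)
  then obtain p where p: "f p = 0" and orth: "\<And>y. f y = 0 \<Longrightarrow> inner (w - p) y = 0"
    using subspace_closure_orthogonal_projection[OF K, of w] by (auto simp: K_def)
  define q where "q = w - p"
  have fq: "f q = f w"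
    by (simp add: q_def f.diff p)
  have "q \<noteq> 0"
    using fq w f.zero by auto
  have "f x = inner x ((f q / inner q q) *\<^sub>R q)" for x
  proof -
    have "inner q (x - (f x / f q) *\<^sub>R q) = 0"
      unfolding q_def by (rule orth) (use fq w in \<open>simp add: f.diff f.scaleR flip: q_def\<close>)
    then have "inner q x = f x / f q * inner q q"
      by (simp add: inner_diff_right)
    then show ?thesis
      using fq w \<open>q \<noteq> 0\<close> by (simp add: inner_commute[of x q])
  qed
  then show ?thesis
    using that by blast
qed

text \<open>The real functionals \<open>inner (T x) y\<close> determine the complex ones because the imaginary part of
  \<open>cinner x y\<close> is the real part of \<open>cinner (- \<i> *\<^sub>C x) y\<close>.\<close>

lemma cinner_adjoint_op:
  assumes T: "bounded_clinear T"
  shows "cinner (T x) y = cinner x (adjoint_op T y)"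
proof -
  have "\<exists>z. \<forall>x. cinner (T x) y = cinner x z" for y
  proof -
    have "bounded_linear (\<lambda>x. inner (T x) y)"
      using bounded_clinear_imp_bounded_linear[OF T] by (rule bounded_linear_inner_left_comp)
    from riesz_representation[OF this] obtain z where z: "\<And>x. inner (T x) y = inner x z"
      by blast
    have "cinner (T x) y = cinner x z" for x
    proof (rule complex_eqI)
      show "Re (cinner (T x) y) = Re (cinner x z)"
        by (simp add: Re_cinner z)
      have "Re (cinner ((- \<i>) *\<^sub>C T x) y) = Re (cinner ((- \<i>) *\<^sub>C x) z)"
        unfolding Re_cinner bounded_clinear_scaleC[OF T, symmetric] by (rule z)
      then show "Im (cinner (T x) y) = Im (cinner x z)"
        by (simp add: cinner_scaleC_left)
    qed
    then show ?thesis
      by blast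
  qed
  then obtain S where S: "\<And>x y. cinner (T x) y = cinner x (S y)"
    by metis
  have "adjoint_op T = S"
    unfolding adjoint_op_def
  proof (rule the_equality)
    fix S' assume "\<forall>x y. cinner (T x) y = cinner x (S' y)"
    with S have "cinner x (S' y) = cinner x (S y)" for x y
      by metis
    then show "S' = S"
      by (intro ext) (rule cinner_ext_right)
  qed (simp add: S)
  then show ?thesis
    by (simp only: S)
qed

lemma cinner_adjoint_op_left:
  assumes "bounded_clinear T"
  shows "cinner (adjoint_op T y) x = cinner y (T x)"
  by (metis assms cinner_adjoint_op cinner_commute)

lemma adjoint_op_eqI:
  assumes "bounded_clinear T" "\<And>x. cinner (T x) y = cinner x z"
  shows "adjoint_op T y = z"
  by (rule cinner_ext_right) (metis assms cinner_adjoint_op)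

lemma linear_adjoint_op:
  assumes "bounded_clinear T"
  shows "linear (adjoint_op T)"
proof (rule linearI)
  show "adjoint_op T (x + y) = adjoint_op T x + adjoint_op T y" for x y
    by (rule adjoint_op_eqI) (simp_all add: assms cinner_add_right cinner_adjoint_op)
  show "adjoint_op T (r *\<^sub>R x) = r *\<^sub>R adjoint_op T x" for r x
    by (rule adjoint_op_eqI)
      (simp_all add: assms cinner_scaleC_right cinner_adjoint_op flip: scaleC_of_real)
qed

text \<open>Apply Cauchy-Schwarz to \<open>cinner (T (adjoint_op T y)) y\<close>, which is the
  squared norm of \<open>adjoint_op T y\<close>, and cancel one factor.\<close>

lemma norm_adjoint_op_le:
  assumes T: "bounded_clinear T" and contr: "\<And>x. norm (T x) \<le> norm x"
  shows "norm (adjoint_op T y) \<le> norm y"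
proof -
  have "(norm (adjoint_op T y))\<^sup>2 = Re (cinner (T (adjoint_op T y)) y)"
    by (simp add: cinner_adjoint_op[OF T] cinner_self)
  also have "\<dots> \<le> norm (T (adjoint_op T y)) * norm y"
    using complex_Re_le_cmod norm_cinner_le order_trans by blast
  also have "\<dots> \<le> norm (adjoint_op T y) * norm y"
    by (intro mult_right_mono contr) simp
  finally show ?thesis
    by (cases "adjoint_op T y = 0") (auto simp: power2_eq_square)
qed

text \<open>A vector orthogonal to the range of the adjoint is annihilated by \<open>T\<close>, so
  by injectivity the error of projecting onto the closure of that range vanishes.\<close>

lemma dense_range_adjoint_op:
  assumes T: "bounded_clinear T" and inj: "\<And>x. T x = 0 \<Longrightarrow> x = 0"
  shows "closure (range (adjoint_op T)) = UNIV"
proof -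
  have sub: "subspace (range (adjoint_op T))"
    using linear_adjoint_op[OF T] subspace_UNIV by (rule linear_subspace_image)
  have "x \<in> closure (range (adjoint_op T))" for x
  proof -
    obtain p where p: "p \<in> closure (range (adjoint_op T))"
      and orth: "\<And>y. y \<in> range (adjoint_op T) \<Longrightarrow> inner (x - p) y = 0"
      using subspace_closure_orthogonal_projection[OF sub] by blast
    have "inner (T (x - p)) y = 0" for y
      using orth[of "adjoint_op T y"] by (metis Re_cinner cinner_adjoint_op[OF T] rangeI)
    then have "T (x - p) = 0"
      using inner_eq_zero_iff by blast
    then have "x - p = 0"
      by (rule inj)
    with p show ?thesis
      by simp
  qed
  then show ?thesis
    by blast
qed

text \<open>Resolves the definite description in \<open>orth_proj\<close>: two candidates differ by
  a vector that lies in \<open>S\<close> and is orthogonal to \<open>S\<close>, hence to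
  itself.\<close>

lemma orth_proj_eqI:
  assumes "subspace S" "p \<in> S" "x - p \<in> orth_compl S"
  shows "orth_proj S x = p"
  unfolding orth_proj_def
proof (rule the_equality)
  fix q assume q: "q \<in> S \<and> x - q \<in> orth_compl S"
  have "q - p \<in> S"
    using assms q by (simp add: subspace_diff)
  then have "cinner (x - p) (q - p) - cinner (x - q) (q - p) = 0"
    using assms q by (simp add: orth_compl_def)
  then have "cinner (q - p) (q - p) = 0"
    by (simp flip: cinner_diff_left)
  then show "q = p"
    by (simp add: cinner_self)
qed (use assms in simp)

lemma subspace_orth_compl: "subspace (orth_compl S)"
  by (auto simp: subspace_def orth_compl_def cinner_add_left cinner_scaleR_left)


subsection \<open>Shifts of square summable sequences\<close>

text \<open>The backward shift, whose adjoint is the forward shift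
  \<open>ell2_cons 0\<close>.\<close>

lift_definition ell2_tl :: "'a :: real_inner ell2 \<Rightarrow> 'a ell2" is "\<lambda>f n. f (Suc n)"
  by (subst summable_Suc_iff)

lift_definition ell2_cons :: "'a :: real_inner \<Rightarrow> 'a ell2 \<Rightarrow> 'a ell2" is "\<lambda>x f. case_nat x f"
  by (subst summable_Suc_iff[symmetric]) simp

lemma ell2_eqI: "(\<And>n. Rep_ell2 f n = Rep_ell2 g n) \<Longrightarrow> f = g"
  by (auto simp flip: Rep_ell2_inject)

lemma ell2_tl_cons [simp]: "ell2_tl (ell2_cons x f) = f"
  by (rule ell2_eqI) (simp add: ell2_tl.rep_eq ell2_cons.rep_eq)

lemma ell2_embed_eq_cons: "ell2_embed v = ell2_cons v 0"
proof -
  have "Rep_ell2 (ell2_cons v 0) = (\<lambda>n. if n = 0 then v else 0)"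
    by (auto simp: ell2_cons.rep_eq zero_ell2.rep_eq fun_eq_iff split: nat.split)
  then show ?thesis
    unfolding ell2_embed_def by (metis Rep_ell2_inverse)
qed

lemma Rep_ell2_tl_funpow: "Rep_ell2 ((ell2_tl ^^ n) f) k = Rep_ell2 f (n + k)"
  by (induction n arbitrary: k) (auto simp: ell2_tl.rep_eq)

text \<open>Peels off the entry at index 0. The state space recursions below all enter through this
  split.\<close>

lemma cinner_ell2_split:
  "cinner f g = cinner (Rep_ell2 f 0) (Rep_ell2 g 0) + cinner (ell2_tl f) (ell2_tl g)"
  unfolding cinner_ell2_def ell2_tl.rep_eq by (subst suminf_split_head) (auto intro: ell2_summable_cinner)

lemma norm_ell2_tl_funpow:
  "(norm ((ell2_tl ^^ n) f))\<^sup>2 = (norm f)\<^sup>2 - (\<Sum>k<n. (norm (Rep_ell2 f k))\<^sup>2)"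
proof -
  have "(norm ((ell2_tl ^^ n) f))\<^sup>2 = (\<Sum>k. (norm (Rep_ell2 f (k + n)))\<^sup>2)"
    by (simp add: norm_ell2_power2 Rep_ell2_tl_funpow add.commute)
  then show ?thesis
    using suminf_split_initial_segment[OF summable_Rep_ell2[of f], of n]
    by (simp add: norm_ell2_power2)
qed

text \<open>The squared norms are the remainders of a convergent series. This limit removes the
  boundary term of the telescoping sum in \<open>norm_adjoint_toep\<close>.\<close>

lemma ell2_tl_funpow_tendsto: "(\<lambda>n. norm ((ell2_tl ^^ n) f)) \<longlonglongrightarrow> 0"
proof -
  have "(\<lambda>n. (norm f)\<^sup>2 - (\<Sum>k<n. (norm (Rep_ell2 f k))\<^sup>2)) \<longlonglongrightarrow> (norm f)\<^sup>2 - (norm f)\<^sup>2"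
    unfolding norm_ell2_power2[of f]
    by (intro tendsto_diff tendsto_const summable_LIMSEQ summable_Rep_ell2)
  then have "(\<lambda>n. sqrt ((norm ((ell2_tl ^^ n) f))\<^sup>2)) \<longlonglongrightarrow> sqrt 0"
    unfolding norm_ell2_tl_funpow by (intro tendsto_real_sqrt) simp
  then show ?thesis
    by simp
qed

lemma bounded_clinear_ell2_embed: "bounded_clinear (ell2_embed :: 'a :: complex_hilbert \<Rightarrow> _)"
proof (rule bounded_clinearI[where K = 1])
  show "ell2_embed (x + y) = ell2_embed x + ell2_embed y" for x y :: 'a
    by (rule ell2_eqI) (simp add: ell2_embed_eq_cons ell2_cons.rep_eq plus_ell2.rep_eq
        zero_ell2.rep_eq split: nat.split)
  show "ell2_embed (a *\<^sub>C x) = a *\<^sub>C ell2_embed x" for a and x :: 'a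
    by (rule ell2_eqI) (simp add: ell2_embed_eq_cons ell2_cons.rep_eq scaleC_ell2.rep_eq
        zero_ell2.rep_eq split: nat.split)
  show "norm (ell2_embed x) \<le> norm x * 1" for x :: 'a
  proof -
    have "cinner (ell2_embed x) (ell2_embed x) = cinner x x"
      by (subst cinner_ell2_split) (simp add: ell2_embed_eq_cons ell2_cons.rep_eq)
    then have "(norm (ell2_embed x))\<^sup>2 = (norm x)\<^sup>2"
      unfolding cinner_self of_real_eq_iff .
    then show ?thesis
      by simp
  qed
qed

lemma adjoint_op_ell2_embed: "adjoint_op ell2_embed h = Rep_ell2 h 0"
  by (rule adjoint_op_eqI, rule bounded_clinear_ell2_embed)
    (subst cinner_ell2_split, simp add: ell2_embed_eq_cons ell2_cons.rep_eq)


subsection \<open>Taylor coefficients\<close>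

text \<open>A power series with a nonzero coefficient has an isolated zero at a root at its centre,
  which is impossible for the zero function.\<close>

lemma powser_coeff_eq_0:
  fixes a :: "nat \<Rightarrow> complex"
  assumes "\<And>z. z \<in> ball 0 1 \<Longrightarrow> (\<lambda>n. a n * z ^ n) sums 0"
  shows "a n = 0"
proof (rule ccontr)
  assume n: "a n \<noteq> 0"
  \<comment> \<open>\<open>powser_0_nonzero\<close> asks for a nonzero coefficient of positive
    index, so index 0 is excluded first by evaluating at the centre.\<close>
  have "a 0 = 0"
    using assms[of 0] by simp
  with n have "0 < n"
    by (cases n) auto
  show False
  proof (rule powser_0_nonzero[where r = 1 and \<xi> = 0 and a = a and f = "\<lambda>_. 0" and m = n])
    fix s :: real
    assume "0 < s" and "\<And>z :: complex. z \<in> cball 0 s - {0} \<Longrightarrow> (0 :: complex) \<noteq> 0"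
    from this(1) this(2)[of "of_real s"] show False
      by simp
  qed (use assms n \<open>0 < n\<close> in auto)
qed

text \<open>Resolves the definite description in \<open>taylor_coeff\<close>. Pairing with a fixed
  \<open>y\<close> reduces uniqueness of operator coefficients to that of scalar power
  series.\<close>

lemma taylor_coeff_eqI:
  fixes F :: "complex \<Rightarrow> 'u :: complex_hilbert \<Rightarrow> 'y :: complex_hilbert"
  assumes c: "\<And>n. bounded_clinear (c n)"
    and F: "\<And>z u. z \<in> ball 0 1 \<Longrightarrow> (\<lambda>n. z ^ n *\<^sub>C c n u) sums F z u"
  shows "taylor_coeff F = c"
  unfolding taylor_coeff_def
proof (rule the_equality)
  fix d assume d: "(\<forall>n. bounded_clinear (d n)) \<and>
    (\<forall>z\<in>ball 0 1. \<forall>u. (\<lambda>n. z ^ n *\<^sub>C d n u) sums F z u)"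
  have "cinner (d n u - c n u) y = 0" for n u y
  proof (rule powser_coeff_eq_0)
    fix z :: complex assume z: "z \<in> ball 0 1"
    have "(\<lambda>n. z ^ n *\<^sub>C d n u - z ^ n *\<^sub>C c n u) sums (F z u - F z u)"
      using d z F[OF z] by (intro sums_diff) auto
    then have "(\<lambda>n. z ^ n *\<^sub>C (d n u - c n u)) sums 0"
      by (simp add: scaleC_diff_right)
    from bounded_linear.sums[OF bounded_linear_cinner_left this, of y]
    show "(\<lambda>n. cinner (d n u - c n u) y * z ^ n) sums 0"
      by (simp add: cinner_scaleC_left mult.commute)
  qed
  then have "d n u - c n u = 0" for n u
    by (intro cinner_ext_left[of _ 0]) simp
  then show "d = c"
    by (simp add: fun_eq_iff)
qed (use assms in auto)

text \<open>Convergence of the difference quotients in operator norm implies weak convergence, with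
  the error multiplied by at most \<open>norm u * norm y\<close>. The scalar form makes the identity
  theorem applicable to \<open>F\<close>.\<close>

lemma schur_class_holomorphic:
  assumes F: "F \<in> schur_class"
  shows "(\<lambda>z. cinner (F z u) y) holomorphic_on ball 0 1"
  unfolding holomorphic_on_def field_differentiable_def
proof
  fix z :: complex assume z: "z \<in> ball 0 1"
  with F obtain D where D: "bounded_clinear D" and
    lim: "((\<lambda>w. onorm (\<lambda>u. inverse (w - z) *\<^sub>C (F w u - F z u) - D u)) \<longlongrightarrow> 0)
      (at z within ball 0 1)"
    unfolding schur_class_def op_analytic_on_def by blast
  have bl: "bounded_linear (F w)" if "w \<in> ball 0 1" for w
    using F that by (simp add: schur_class_def bounded_clinear_def)
  have "((\<lambda>w. (cinner (F w u) y - cinner (F z u) y) / (w - z) - cinner (D u) y) \<longlongrightarrow> 0)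
      (at z within ball 0 1)"
  proof (rule Lim_null_comparison)
    show "((\<lambda>w. onorm (\<lambda>u. inverse (w - z) *\<^sub>C (F w u - F z u) - D u) * norm u * norm y) \<longlongrightarrow> 0)
        (at z within ball 0 1)"
      using lim by (intro tendsto_mult_left_zero)
    show "\<forall>\<^sub>F w in at z within ball 0 1.
        norm ((cinner (F w u) y - cinner (F z u) y) / (w - z) - cinner (D u) y)
        \<le> onorm (\<lambda>u. inverse (w - z) *\<^sub>C (F w u - F z u) - D u) * norm u * norm y"
      unfolding eventually_at_filter
    proof (intro always_eventually allI impI)
      fix w :: complex assume w: "w \<in> ball 0 1"
      let ?g = "\<lambda>u. inverse (w - z) *\<^sub>C (F w u - F z u) - D u"
      have "bounded_linear ?g"
        using bounded_clinear_imp_bounded_linear[OF D]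
        by (intro bounded_linear_sub bounded_linear_compose[OF bounded_linear_scaleC] bl w z)
      then have "norm (?g u) * norm y \<le> onorm ?g * norm u * norm y"
        by (intro mult_right_mono onorm) auto
      moreover have "(cinner (F w u) y - cinner (F z u) y) / (w - z) - cinner (D u) y
          = cinner (?g u) y"
        by (simp add: cinner_diff_left cinner_scaleC_left divide_inverse mult.commute)
      ultimately show "norm ((cinner (F w u) y - cinner (F z u) y) / (w - z) - cinner (D u) y)
          \<le> onorm ?g * norm u * norm y"
        using norm_cinner_le[of "?g u" y] by simp
    qed
  qed
  then have "((\<lambda>z. cinner (F z u) y) has_field_derivative cinner (D u) y) (at z within ball 0 1)"
    unfolding has_field_derivative_iff by (subst Lim_null)
  then show "\<exists>f'. ((\<lambda>z. cinner (F z u) y) has_field_derivative f') (at z within ball 0 1)"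
    by blast
qed


subsection \<open>Co-isometric systems\<close>

locale coisometric_system =
  fixes \<alpha> :: "'x :: complex_hilbert \<Rightarrow> 'x" and \<beta> :: "'u :: complex_hilbert \<Rightarrow> 'x"
    and \<gamma> :: "'x \<Rightarrow> 'y :: complex_hilbert" and \<delta> :: "'u \<Rightarrow> 'y"
  assumes ops: "system_ops \<alpha> \<beta> \<gamma> \<delta>"
    and coiso: "co_isometric \<alpha> \<beta> \<gamma> \<delta>"
begin

section \<open>The system matrix as a co-isometry\<close>

abbreviation "sysmat \<equiv> system_matrix \<alpha> \<beta> \<gamma> \<delta>"

lemma bounded_clinear_ops:
  "bounded_clinear \<alpha>" "bounded_clinear \<beta>" "bounded_clinear \<gamma>" "bounded_clinear \<delta>"
  using ops by (simp_all add: system_ops_def)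

lemmas bounded_linear_ops = bounded_clinear_ops[THEN bounded_clinear_imp_bounded_linear]

lemmas linear_ops = bounded_linear_ops[THEN bounded_linear.linear]

lemmas ops_simps =
  linear_ops[THEN linear_0] linear_ops[THEN linear_add] bounded_clinear_ops[THEN bounded_clinear_scaleC]

lemma bounded_clinear_sysmat: "bounded_clinear sysmat"
proof -
  have "bounded_linear (\<lambda>p. (\<delta> (fst p) + \<gamma> (snd p), \<beta> (fst p) + \<alpha> (snd p)))"
    by (intro bounded_linear_Pair bounded_linear_add bounded_linear_compose[OF _ bounded_linear_fst]
        bounded_linear_compose[OF _ bounded_linear_snd] bounded_linear_ops)
  moreover have "sysmat = (\<lambda>p. (\<delta> (fst p) + \<gamma> (snd p), \<beta> (fst p) + \<alpha> (snd p)))"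
    by (auto simp: system_matrix_def fun_eq_iff)
  ultimately show ?thesis
    by (simp add: bounded_clinear_def scaleC_prod_def ops_simps scaleC_add_right)
qed

lemma sysmat_adjoint: "sysmat (adjoint_op sysmat w) = w"
  using coiso unfolding co_isometric_def by (metis comp_apply id_apply)

lemma norm_adjoint_sysmat: "norm (adjoint_op sysmat w) = norm w"
proof -
  have "cinner (adjoint_op sysmat w) (adjoint_op sysmat w) = cinner w w"
    by (simp add: cinner_adjoint_op_left[OF bounded_clinear_sysmat] sysmat_adjoint)
  then have "(norm (adjoint_op sysmat w))\<^sup>2 = (norm w)\<^sup>2"
    unfolding cinner_self of_real_eq_iff .
  then show ?thesis
    by simp
qed

lemma norm_sysmat_le: "norm (sysmat v) \<le> norm v"
proof -
  have "(norm (sysmat v))\<^sup>2 = Re (cinner v (adjoint_op sysmat (sysmat v)))"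
    by (simp add: cinner_self flip: cinner_adjoint_op[OF bounded_clinear_sysmat])
  also have "\<dots> \<le> norm v * norm (sysmat v)"
    by (metis norm_adjoint_sysmat norm_cinner_le complex_Re_le_cmod order_trans)
  finally show ?thesis
    by (cases "sysmat v = 0") (auto simp: power2_eq_square)
qed

text \<open>Completing the square, since the adjoint is isometric: the best approximation of
  \<open>v\<close> from the range of the adjoint is attained at \<open>w = sysmat v\<close>.\<close>

lemma norm_sysmat_diff:
  "(norm (v - adjoint_op sysmat w))\<^sup>2
    = (norm v)\<^sup>2 - (norm (sysmat v))\<^sup>2 + (norm (w - sysmat v))\<^sup>2"
  by (simp add: norm_diff_square norm_adjoint_sysmat cinner_commute[of w]
      flip: cinner_adjoint_op[OF bounded_clinear_sysmat])

lemma norm_step_le: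
  "(norm (\<delta> u + \<gamma> x))\<^sup>2 + (norm (\<beta> u + \<alpha> x))\<^sup>2 \<le> (norm u)\<^sup>2 + (norm x)\<^sup>2"
proof -
  have "(norm (sysmat (u, x)))\<^sup>2 \<le> (norm (u, x))\<^sup>2"
    by (intro power_mono norm_sysmat_le) simp
  then show ?thesis
    by (simp add: system_matrix_def norm_prod_def)
qed

lemma norm_obs_step_le: "(norm (\<gamma> x))\<^sup>2 + (norm (\<alpha> x))\<^sup>2 \<le> (norm x)\<^sup>2"
  using norm_step_le[of 0 x] by (simp add: ops_simps)

lemma norm_funpow_le: "norm ((\<alpha> ^^ n) x) \<le> norm x"
proof (induction n)
  case (Suc n)
  have "(norm (\<alpha> ((\<alpha> ^^ n) x)))\<^sup>2 \<le> (norm ((\<alpha> ^^ n) x))\<^sup>2"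
    using norm_obs_step_le[of "(\<alpha> ^^ n) x"] zero_le_power2[of "norm (\<gamma> ((\<alpha> ^^ n) x))"] by linarith
  then have "norm (\<alpha> ((\<alpha> ^^ n) x)) \<le> norm ((\<alpha> ^^ n) x)"
    by (rule power2_le_imp_le) simp
  with Suc show ?case
    by simp
qed simp

section \<open>The observability operator\<close>

definition obs :: "'x \<Rightarrow> 'y ell2"
  where "obs x = Abs_ell2 (\<lambda>n. \<gamma> ((\<alpha> ^^ n) x))"

text \<open>Energy balance without input: the energy emitted so far plus that of the current state
  never exceeds the initial energy.\<close>

lemma obs_partial_sum:
  "(\<Sum>k<n. (norm (\<gamma> ((\<alpha> ^^ k) x)))\<^sup>2) + (norm ((\<alpha> ^^ n) x))\<^sup>2 \<le> (norm x)\<^sup>2"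
proof (induction n)
  case (Suc n)
  then show ?case
    using norm_obs_step_le[of "(\<alpha> ^^ n) x"] by simp
qed simp

lemma obs_partial_sum_le: "(\<Sum>k<n. (norm (\<gamma> ((\<alpha> ^^ k) x)))\<^sup>2) \<le> (norm x)\<^sup>2"
  using obs_partial_sum[of x n] zero_le_power2[of "norm ((\<alpha> ^^ n) x)"] by linarith

lemma Rep_obs: "Rep_ell2 (obs x) n = \<gamma> ((\<alpha> ^^ n) x)"
proof -
  have "summable (\<lambda>n. (norm (\<gamma> ((\<alpha> ^^ n) x)))\<^sup>2)"
    by (rule bounded_imp_summable[where B = "(norm x)\<^sup>2"])
      (use obs_partial_sum_le[of x] in \<open>auto simp flip: lessThan_Suc_atMost simp del: sum.lessThan_Suc\<close>)
  then show ?thesis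
    by (simp add: obs_def Abs_ell2_inverse)
qed

lemma norm_obs_le: "norm (obs x) \<le> norm x"
proof (rule power2_le_imp_le)
  show "(norm (obs x))\<^sup>2 \<le> (norm x)\<^sup>2"
    unfolding norm_ell2_power2
    by (intro suminf_le_const summable_Rep_ell2) (simp add: Rep_obs obs_partial_sum_le)
qed simp

lemma bounded_clinear_obs: "bounded_clinear obs"
proof (rule bounded_clinearI[where K = 1])
  have bc: "bounded_clinear (\<lambda>x. \<gamma> ((\<alpha> ^^ n) x))" for n
    by (rule bounded_clinear_compose[OF bounded_clinear_ops(3)
          bounded_clinear_funpow[OF bounded_clinear_ops(1)]])
  show "obs (x + y) = obs x + obs y" for x y
    by (rule ell2_eqI) (simp add: Rep_obs plus_ell2.rep_eq
        linear_add[OF bounded_linear.linear[OF bounded_clinear_imp_bounded_linear[OF bc]]])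
  show "obs (a *\<^sub>C x) = a *\<^sub>C obs x" for a x
    by (rule ell2_eqI) (simp add: Rep_obs scaleC_ell2.rep_eq bounded_clinear_scaleC[OF bc])
qed (simp add: norm_obs_le)

text \<open>The backward shift intertwines with \<open>\<alpha>\<close>: dropping the first output
  amounts to starting one step later.\<close>

lemma ell2_tl_obs: "ell2_tl (obs x) = obs (\<alpha> x)"
  by (rule ell2_eqI) (simp add: ell2_tl.rep_eq Rep_obs funpow_swap1)

section \<open>Markov parameters and the Toeplitz operator\<close>

text \<open>These are the Taylor coefficients at 0 of the transfer function, by
  \<open>markov_sums\<close>.\<close>

definition markov :: "nat \<Rightarrow> 'u \<Rightarrow> 'y"
  where "markov n = (case n of 0 \<Rightarrow> \<delta> | Suc k \<Rightarrow> (\<lambda>u. \<gamma> ((\<alpha> ^^ k) (\<beta> u))))"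

lemma bounded_clinear_markov: "bounded_clinear (markov n)"
proof (cases n)
  case 0
  then show ?thesis
    by (simp add: markov_def bounded_clinear_ops)
next
  case (Suc k)
  have "bounded_clinear (\<lambda>u. \<gamma> ((\<alpha> ^^ k) (\<beta> u)))"
    by (rule bounded_clinear_compose[OF bounded_clinear_ops(3)
          bounded_clinear_compose[OF bounded_clinear_funpow[OF bounded_clinear_ops(1)]
            bounded_clinear_ops(2)]])
  then show ?thesis
    by (simp add: Suc markov_def)
qed

lemmas linear_markov =
  bounded_linear.linear[OF bounded_clinear_imp_bounded_linear[OF bounded_clinear_markov]]

text \<open>Depends on the system alone; it becomes \<open>toeplitz F\<close> once
  \<open>taylor_coeff_realization\<close> identifies the coefficients.\<close>

definition toep :: "'u ell2 \<Rightarrow> 'y ell2"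
  where "toep g = Abs_ell2 (\<lambda>n. \<Sum>k\<le>n. markov (n - k) (Rep_ell2 g k))"

text \<open>The trajectory under the input \<open>f\<close> from the zero state. It turns
  contractivity of \<open>toep\<close> into a stepwise energy balance.\<close>

primrec state :: "(nat \<Rightarrow> 'u) \<Rightarrow> nat \<Rightarrow> 'x"
  where
    "state f 0 = 0"
  | "state f (Suc n) = \<beta> (f n) + \<alpha> (state f n)"

lemma state_eq: "state f n = (\<Sum>k<n. (\<alpha> ^^ (n - Suc k)) (\<beta> (f k)))"
proof (induction n)
  case (Suc n)
  have "\<alpha> (\<Sum>k<n. (\<alpha> ^^ (n - Suc k)) (\<beta> (f k))) = (\<Sum>k<n. (\<alpha> ^^ (n - k)) (\<beta> (f k)))"
    unfolding linear_sum[OF linear_ops(1)]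
  proof (rule sum.cong)
    fix k assume "k \<in> {..<n}"
    then have "n - k = Suc (n - Suc k)"
      by simp
    then show "\<alpha> ((\<alpha> ^^ (n - Suc k)) (\<beta> (f k))) = (\<alpha> ^^ (n - k)) (\<beta> (f k))"
      by simp
  qed simp
  then show ?case
    by (simp add: Suc.IH)
qed simp

text \<open>Unrolling the recursion for the state turns the output into a convolution;
  \<open>\<delta>\<close> supplies the term \<open>k = n\<close>.\<close>

lemma output_eq: "\<delta> (f n) + \<gamma> (state f n) = (\<Sum>k\<le>n. markov (n - k) (f k))"
proof -
  have "\<gamma> (state f n) = (\<Sum>k<n. markov (n - k) (f k))"
    unfolding state_eq linear_sum[OF linear_ops(3)]
  proof (rule sum.cong)
    fix k assume "k \<in> {..<n}"
    then have "n - k = Suc (n - Suc k)"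
      by simp
    then show "\<gamma> ((\<alpha> ^^ (n - Suc k)) (\<beta> (f k))) = markov (n - k) (f k)"
      by (simp add: markov_def)
  qed simp
  then show ?thesis
    by (simp add: markov_def[of 0] flip: lessThan_Suc_atMost)
qed

lemma toep_partial_sum_le:
  "(\<Sum>k<n. (norm (\<Sum>j\<le>k. markov (k - j) (f j)))\<^sup>2) \<le> (\<Sum>k<n. (norm (f k))\<^sup>2)"
proof -
  \<comment> \<open>The energy of the final state is carried along to make the induction work, and
    is discarded afterwards.\<close>
  have "(\<Sum>k<n. (norm (\<delta> (f k) + \<gamma> (state f k)))\<^sup>2) + (norm (state f n))\<^sup>2
      \<le> (\<Sum>k<n. (norm (f k))\<^sup>2)"
  proof (induction n)
    case (Suc n)
    then show ?case
      using norm_step_le[of "f n" "state f n"] by simp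
  qed simp
  then show ?thesis
    unfolding output_eq using zero_le_power2[of "norm (state f n)"] by linarith
qed

lemma toep_partial_sum_le_norm:
  "(\<Sum>k<n. (norm (\<Sum>j\<le>k. markov (k - j) (Rep_ell2 g j)))\<^sup>2) \<le> (norm g)\<^sup>2"
  using toep_partial_sum_le ell2_partial_sum_le by (rule order_trans)

lemma Rep_toep: "Rep_ell2 (toep g) n = (\<Sum>k\<le>n. markov (n - k) (Rep_ell2 g k))"
proof -
  \<comment> \<open>\<open>bounded_imp_summable\<close> bounds sums over \<open>{..n}\<close>, hence
    the instance at \<open>Suc n\<close>.\<close>
  have "(\<Sum>k\<le>n. (norm (\<Sum>j\<le>k. markov (k - j) (Rep_ell2 g j)))\<^sup>2) \<le> (norm g)\<^sup>2" for n
    using toep_partial_sum_le_norm[of g "Suc n"] by (simp only: lessThan_Suc_atMost)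
  then have "summable (\<lambda>n. (norm (\<Sum>k\<le>n. markov (n - k) (Rep_ell2 g k)))\<^sup>2)"
    by (intro bounded_imp_summable[where B = "(norm g)\<^sup>2"]) auto
  then show ?thesis
    by (simp add: toep_def Abs_ell2_inverse)
qed

lemma norm_toep_le: "norm (toep g) \<le> norm g"
proof (rule power2_le_imp_le)
  show "(norm (toep g))\<^sup>2 \<le> (norm g)\<^sup>2"
    unfolding norm_ell2_power2[of "toep g"]
    by (intro suminf_le_const summable_Rep_ell2) (simp add: Rep_toep toep_partial_sum_le_norm)
qed simp

lemma bounded_clinear_toep: "bounded_clinear toep"
proof (rule bounded_clinearI[where K = 1])
  show "toep (x + y) = toep x + toep y" for x y
    by (rule ell2_eqI)
      (simp add: Rep_toep plus_ell2.rep_eq linear_add[OF linear_markov] sum.distrib)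
  show "toep (a *\<^sub>C x) = a *\<^sub>C toep x" for a x
    by (rule ell2_eqI)
      (simp add: Rep_toep scaleC_ell2.rep_eq bounded_clinear_scaleC[OF bounded_clinear_markov]
        linear_sum[OF bounded_linear.linear[OF bounded_linear_scaleC]])
qed (simp add: norm_toep_le)

text \<open>The first input \<open>u\<close> acts at once through \<open>\<delta>\<close> and leaves
  the state \<open>\<beta> u\<close>, whose free evolution contributes
  \<open>obs (\<beta> u)\<close>; the later inputs are answered with a delay of one step.\<close>

lemma toep_cons: "toep (ell2_cons u g) = ell2_cons (\<delta> u) (obs (\<beta> u) + toep g)"
proof (rule ell2_eqI)
  fix n
  show "Rep_ell2 (toep (ell2_cons u g)) n = Rep_ell2 (ell2_cons (\<delta> u) (obs (\<beta> u) + toep g)) n"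
  proof (cases n)
    case 0
    then show ?thesis
      by (simp add: Rep_toep ell2_cons.rep_eq markov_def)
  next
    case (Suc m)
    then show ?thesis
      by (simp add: Rep_toep ell2_cons.rep_eq plus_ell2.rep_eq Rep_obs sum.atMost_Suc_shift
          markov_def[of "Suc m"] del: sum.atMost_Suc)
  qed
qed

section \<open>The defect identity for the Toeplitz operator\<close>

text \<open>The adjoint form of the fact that \<open>toep\<close> commutes with the forward
  shift.\<close>

lemma ell2_tl_adjoint_toep: "ell2_tl (adjoint_op toep h) = adjoint_op toep (ell2_tl h)"
proof (rule cinner_ext_right)
  fix g
  have "cinner g (ell2_tl (adjoint_op toep h)) = cinner (ell2_cons 0 g) (adjoint_op toep h)"
    by (subst (2) cinner_ell2_split) (simp add: ell2_cons.rep_eq)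
  also have "\<dots> = cinner (toep (ell2_cons 0 g)) h"
    by (simp add: cinner_adjoint_op[OF bounded_clinear_toep])
  also have "\<dots> = cinner (toep g) (ell2_tl h)"
  proof -
    have "obs 0 = 0"
      by (intro linear_0 bounded_linear.linear bounded_clinear_imp_bounded_linear bounded_clinear_obs)
    then show ?thesis
      by (subst cinner_ell2_split) (simp add: toep_cons ops_simps ell2_cons.rep_eq)
  qed
  finally show "cinner g (ell2_tl (adjoint_op toep h)) = cinner g (adjoint_op toep (ell2_tl h))"
    by (simp add: cinner_adjoint_op[OF bounded_clinear_toep])
qed

lemma funpow_tl_adjoint_toep:
  "(ell2_tl ^^ n) (adjoint_op toep h) = adjoint_op toep ((ell2_tl ^^ n) h)"
  by (induction n) (simp_all add: ell2_tl_adjoint_toep)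

text \<open>Test against \<open>(u, x)\<close>: \<open>toep\<close> sends the embedded
  \<open>u\<close> to \<open>(\<delta> u, obs (\<beta> u))\<close>, and \<open>obs x\<close> is
  \<open>(\<gamma> x, obs (\<alpha> x))\<close>. Together these are the entries of the system
  matrix, with \<open>obs\<close> applied to the state component.\<close>

lemma adjoint_sysmat_obs:
  "adjoint_op sysmat (Rep_ell2 h 0, adjoint_op obs (ell2_tl h))
    = (Rep_ell2 (adjoint_op toep h) 0, adjoint_op obs h)"
proof (rule adjoint_op_eqI[OF bounded_clinear_sysmat])
  fix p :: "'u \<times> 'x"
  obtain u x where p: "p = (u, x)"
    by fastforce
  have toep0: "toep 0 = 0" and obs_add: "obs (y + z) = obs y + obs z" for y z
    by (intro linear_0 linear_add bounded_linear.linear bounded_clinear_imp_bounded_linear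
        bounded_clinear_toep bounded_clinear_obs)+
  \<comment> \<open>Evaluation at index 0 is the adjoint of \<open>ell2_embed\<close>, so this entry
    is tested by inputs supported there.\<close>
  have "cinner u (Rep_ell2 (adjoint_op toep h) 0) = cinner (toep (ell2_embed u)) h"
    unfolding cinner_adjoint_op[OF bounded_clinear_toep]
      cinner_adjoint_op[OF bounded_clinear_ell2_embed] adjoint_op_ell2_embed ..
  also have "\<dots> = cinner (\<delta> u) (Rep_ell2 h 0) + cinner (obs (\<beta> u)) (ell2_tl h)"
    by (subst cinner_ell2_split) (simp add: ell2_embed_eq_cons toep_cons toep0 ell2_cons.rep_eq)
  finally have U: "cinner u (Rep_ell2 (adjoint_op toep h) 0) = \<dots>" .
  have "cinner x (adjoint_op obs h) = cinner (obs x) h"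
    by (rule cinner_adjoint_op[OF bounded_clinear_obs, symmetric])
  also have "\<dots> = cinner (\<gamma> x) (Rep_ell2 h 0) + cinner (obs (\<alpha> x)) (ell2_tl h)"
    by (subst cinner_ell2_split) (simp add: ell2_tl_obs Rep_obs)
  finally show "cinner (sysmat p) (Rep_ell2 h 0, adjoint_op obs (ell2_tl h))
      = cinner p (Rep_ell2 (adjoint_op toep h) 0, adjoint_op obs h)"
    using U by (simp add: p system_matrix_def cinner_prod_def cinner_add_left obs_add
        flip: cinner_adjoint_op[OF bounded_clinear_obs])
qed

text \<open>The identity \<open>I - T T^* = W W^*\<close> as quadratic forms. Each entry of
  \<open>T^* h\<close> differs in squared norm from that of \<open>h\<close> by an increment of
  \<open>e\<close>, and these increments telescope to \<open>- e 0\<close>.\<close>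

lemma norm_adjoint_toep:
  "(norm (adjoint_op toep h))\<^sup>2 = (norm h)\<^sup>2 - (norm (adjoint_op obs h))\<^sup>2"
proof -
  define e where "e n = (norm (adjoint_op obs ((ell2_tl ^^ n) h)))\<^sup>2" for n
  have step: "(norm (Rep_ell2 (adjoint_op toep g) 0))\<^sup>2
      = (norm (Rep_ell2 g 0))\<^sup>2 + (norm (adjoint_op obs (ell2_tl g)))\<^sup>2 - (norm (adjoint_op obs g))\<^sup>2"
    for g
    using norm_adjoint_sysmat[of "(Rep_ell2 g 0, adjoint_op obs (ell2_tl g))"]
    unfolding adjoint_sysmat_obs by (simp add: norm_prod_def)
  \<comment> \<open>Tails of \<open>T^* h\<close> are \<open>T^*\<close> of the tails of
    \<open>h\<close>, so \<open>step\<close> at the tail from index \<open>n\<close> reads off entry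
    \<open>n\<close>.\<close>
  have coeff: "(norm (Rep_ell2 (adjoint_op toep h) n))\<^sup>2
      = (norm (Rep_ell2 h n))\<^sup>2 + (e (Suc n) - e n)" for n
    using step[of "(ell2_tl ^^ n) h"]
    by (simp add: Rep_ell2_tl_funpow e_def flip: funpow_tl_adjoint_toep)
  have "(\<lambda>n. norm (adjoint_op obs ((ell2_tl ^^ n) h))) \<longlonglongrightarrow> 0"
    using ell2_tl_funpow_tendsto[of h]
    by (rule Lim_null_comparison[rotated])
      (simp add: norm_adjoint_op_le[OF bounded_clinear_obs norm_obs_le])
  then have "(\<lambda>n. (norm (adjoint_op obs ((ell2_tl ^^ n) h)))\<^sup>2) \<longlonglongrightarrow> 0\<^sup>2"
    by (rule tendsto_power)
  then have "e \<longlonglongrightarrow> 0"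
    unfolding e_def by simp
  then have "(\<lambda>n. e (Suc n) - e n) sums (0 - e 0)"
    by (rule telescope_sums)
  moreover have "(\<lambda>n. (norm (Rep_ell2 h n))\<^sup>2) sums (norm h)\<^sup>2"
    unfolding norm_ell2_power2 by (intro summable_sums summable_Rep_ell2)
  ultimately have "(\<lambda>n. (norm (Rep_ell2 (adjoint_op toep h) n))\<^sup>2) sums ((norm h)\<^sup>2 + (0 - e 0))"
    unfolding coeff by (rule sums_add[rotated])
  then show ?thesis
    unfolding norm_ell2_power2[of "adjoint_op toep h"] by (simp add: sums_iff e_def)
qed

text \<open>The defect term is the squared norm of \<open>adjoint_op obs h\<close>, so both terms
  are components of the squared distance from \<open>(u, 0)\<close> to a point of the range of the
  adjoint. Since \<open>sysmat (u, 0) = (\<delta> u, \<beta> u)\<close>,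
  \<open>norm_sysmat_diff\<close> isolates the part depending on \<open>h\<close>.\<close>

lemma entropy_functional_eq:
  "(norm (u - adjoint_op ell2_embed (adjoint_op toep h)))\<^sup>2
      + Re (cinner (h - toep (adjoint_op toep h)) h)
    = (norm u)\<^sup>2 - (norm (sysmat (u, 0)))\<^sup>2
      + ((norm (Rep_ell2 h 0 - \<delta> u))\<^sup>2 + (norm (adjoint_op obs (ell2_tl h) - \<beta> u))\<^sup>2)"
proof -
  have "Re (cinner (h - toep (adjoint_op toep h)) h) = (norm (adjoint_op obs h))\<^sup>2"
    using norm_adjoint_toep[of h]
    by (simp add: cinner_diff_left cinner_adjoint_op[OF bounded_clinear_toep] cinner_self)
  then have "(norm (u - adjoint_op ell2_embed (adjoint_op toep h)))\<^sup>2
      + Re (cinner (h - toep (adjoint_op toep h)) h)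
      = (norm ((u, 0) - adjoint_op sysmat (Rep_ell2 h 0, adjoint_op obs (ell2_tl h))))\<^sup>2"
    unfolding adjoint_sysmat_obs adjoint_op_ell2_embed by (simp add: norm_prod_def)
  then show ?thesis
    unfolding norm_sysmat_diff by (simp add: norm_prod_def system_matrix_def ops_simps)
qed

section \<open>The transfer function and its Taylor coefficients\<close>

text \<open>The powers of \<open>\<alpha>\<close> are contractions, so a geometric series dominates
  on the whole disc; shifting the index shows that the sum \<open>s\<close> solves
  \<open>s - z *\<^sub>C \<alpha> s = x\<close>.\<close>

lemma neumann_series:
  assumes z: "cmod z < 1"
  shows "(\<lambda>n. z ^ n *\<^sub>C (\<alpha> ^^ n) x) sums inv (\<lambda>x. x - z *\<^sub>C \<alpha> x) x"
proof -
  have "summable (\<lambda>n. z ^ n *\<^sub>C (\<alpha> ^^ n) x)"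
  proof (rule summable_comparison_test')
    show "summable (\<lambda>n. cmod z ^ n * norm x)"
      using z by (intro summable_mult2 summable_geometric) simp
    show "norm (z ^ n *\<^sub>C (\<alpha> ^^ n) x) \<le> cmod z ^ n * norm x" for n
      by (simp add: norm_scaleC norm_power mult_left_mono norm_funpow_le)
  qed
  then obtain s where s: "(\<lambda>n. z ^ n *\<^sub>C (\<alpha> ^^ n) x) sums s"
    by (auto simp: summable_def)
  have "(\<lambda>n. z *\<^sub>C \<alpha> (z ^ n *\<^sub>C (\<alpha> ^^ n) x)) sums (z *\<^sub>C \<alpha> s)"
    by (intro bounded_linear.sums[OF bounded_linear_scaleC] bounded_linear.sums[OF bounded_linear_ops(1)] s)
  then have "(\<lambda>n. z ^ Suc n *\<^sub>C (\<alpha> ^^ Suc n) x) sums (z *\<^sub>C \<alpha> s)"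
    by (simp add: ops_simps scaleC_scaleC)
  from sums_Suc[OF this] have "s = z *\<^sub>C \<alpha> s + x"
    using s by (simp add: sums_unique2)
  then have sx: "s - z *\<^sub>C \<alpha> s = x"
    by (metis add_diff_cancel_left')
  \<comment> \<open>\<open>inv\<close> chooses some preimage; injectivity forces the choice to be
    \<open>s\<close>.\<close>
  have "inj (\<lambda>x. x - z *\<^sub>C \<alpha> x)"
  proof (rule injI)
    fix a b assume "a - z *\<^sub>C \<alpha> a = b - z *\<^sub>C \<alpha> b"
    then have "a - b = z *\<^sub>C \<alpha> (a - b)"
      by (simp add: linear_diff[OF linear_ops(1)] scaleC_diff_right algebra_simps)
    then have "norm (a - b) = cmod z * norm (\<alpha> (a - b))"
      by (metis norm_scaleC)
    also have "\<dots> \<le> cmod z * norm (a - b)"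
      using norm_funpow_le[of 1 "a - b"] by (simp add: mult_left_mono)
    finally have "(1 - cmod z) * norm (a - b) \<le> 0"
      by (simp add: algebra_simps)
    with z show "a = b"
      by (simp add: mult_le_0_iff)
  qed
  from inv_f_eq[OF this sx] s show ?thesis
    by simp
qed

lemma markov_sums:
  assumes z: "cmod z < 1"
  shows "(\<lambda>n. z ^ n *\<^sub>C markov n u) sums (\<delta> u + z *\<^sub>C \<gamma> (inv (\<lambda>x. x - z *\<^sub>C \<alpha> x) (\<beta> u)))"
proof -
  have "(\<lambda>n. z *\<^sub>C \<gamma> (z ^ n *\<^sub>C (\<alpha> ^^ n) (\<beta> u))) sums
      (z *\<^sub>C \<gamma> (inv (\<lambda>x. x - z *\<^sub>C \<alpha> x) (\<beta> u)))"
    by (intro bounded_linear.sums[OF bounded_linear_scaleC] bounded_linear.sums[OF bounded_linear_ops(3)]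
        neumann_series z)
  then have "(\<lambda>n. z ^ Suc n *\<^sub>C markov (Suc n) u) sums
      (z *\<^sub>C \<gamma> (inv (\<lambda>x. x - z *\<^sub>C \<alpha> x) (\<beta> u)))"
    by (simp add: markov_def ops_simps scaleC_scaleC)
  \<comment> \<open>Restores the term at index 0, which is \<open>\<delta> u\<close>.\<close>
  from sums_Suc[OF this] show ?thesis
    by (simp add: markov_def[of 0] add.commute)
qed

text \<open>The realization formula holds only near 0. The identity theorem, applied to the scalar
  functions obtained by pairing with \<open>y\<close>, extends it to the disc, where the Markov
  series converges.\<close>

lemma taylor_coeff_realization:
  fixes F :: "complex \<Rightarrow> 'u \<Rightarrow> 'y"
  assumes F: "F \<in> schur_class" and real: "realization \<alpha> \<beta> \<gamma> \<delta> F"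
  shows "taylor_coeff F = markov"
proof (rule taylor_coeff_eqI[OF bounded_clinear_markov])
  define G where "G z u = \<delta> u + z *\<^sub>C \<gamma> (inv (\<lambda>x. x - z *\<^sub>C \<alpha> x) (\<beta> u))" for z u
  have G: "(\<lambda>n. z ^ n *\<^sub>C markov n u) sums G z u" if "z \<in> ball 0 1" for z u
    unfolding G_def using that by (intro markov_sums) simp
  obtain U where U: "open U" "0 \<in> U" "\<And>z u. z \<in> U \<Longrightarrow> F z u = G z u"
    using real unfolding realization_def eventually_nhds G_def by blast
  have "F z u = G z u" if z: "z \<in> ball 0 1" for z u
  proof (rule cinner_ext_left)
    fix y
    show "cinner (F z u) y = cinner (G z u) y"
    proof (rule analytic_continuation_open[where f = "\<lambda>z. cinner (F z u) y"
          and g = "\<lambda>z. cinner (G z u) y" and s = "U \<inter> ball 0 1" and s' = "ball 0 1"])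
      show "(\<lambda>z. cinner (F z u) y) holomorphic_on ball 0 1"
        by (rule schur_class_holomorphic[OF F])
      show "(\<lambda>z. cinner (G z u) y) holomorphic_on ball 0 1"
      proof (rule power_series_holomorphic)
        fix w :: complex assume "w \<in> ball 0 1"
        from bounded_linear.sums[OF bounded_linear_cinner_left G[OF this], of u y]
        show "(\<lambda>n. cinner (markov n u) y * (w - 0) ^ n) sums cinner (G w u) y"
          by (simp add: cinner_scaleC_left mult.commute)
      qed
    qed (use U z in auto)
  qed
  with G show "(\<lambda>n. z ^ n *\<^sub>C markov n u) sums F z u" if "z \<in> ball 0 1" for z u
    using that by simp
qed

section \<open>The projection and the value of the infimum\<close>

text \<open>For a co-isometry \<open>M\<close> the operator \<open>M^* M\<close> is the orthogonal
  projection onto the range of \<open>M^*\<close>, so \<open>I - M^* M\<close> projects onto its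
  complement.\<close>

lemma orth_proj_eq:
  "orth_proj (orth_compl (range (adjoint_op sysmat))) v = v - adjoint_op sysmat (sysmat v)"
proof (rule orth_proj_eqI[OF subspace_orth_compl])
  show orth: "v - adjoint_op sysmat (sysmat v) \<in> orth_compl (range (adjoint_op sysmat))"
    by (auto simp: orth_compl_def sysmat_adjoint
        linear_diff[OF bounded_linear.linear[OF bounded_clinear_imp_bounded_linear[OF bounded_clinear_sysmat]]]
        simp flip: cinner_adjoint_op[OF bounded_clinear_sysmat])
  show "v - (v - adjoint_op sysmat (sysmat v)) \<in> orth_compl (orth_compl (range (adjoint_op sysmat)))"
    unfolding orth_compl_def
  proof (clarsimp simp del: split_paired_All)
    fix a b
    assume "\<forall>w. cinner (a, b) (adjoint_op sysmat w) = 0"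
    then show "cinner (adjoint_op sysmat (sysmat v)) (a, b) = 0"
      by (metis cinner_commute complex_cnj_zero)
  qed
qed

lemma cinner_orth_proj:
  "cinner (orth_proj (orth_compl (range (adjoint_op sysmat))) v) v
    = complex_of_real ((norm v)\<^sup>2 - (norm (sysmat v))\<^sup>2)"
  by (simp add: orth_proj_eq cinner_diff_left cinner_adjoint_op_left[OF bounded_clinear_sysmat]
      cinner_self)

text \<open>After \<open>entropy_functional_eq\<close> only two squares depend on \<open>h\<close>,
  through its first entry and its tail separately. The first can be made zero, and the second
  arbitrarily small by density.\<close>

lemma entropy_eq:
  assumes F: "F \<in> schur_class" and real: "realization \<alpha> \<beta> \<gamma> \<delta> F" and obsv: "observable \<alpha> \<gamma>"
  shows "entropy F u = (norm u)\<^sup>2 - (norm (sysmat (u, 0)))\<^sup>2"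
proof -
  define d where "d = (norm u)\<^sup>2 - (norm (sysmat (u, 0)))\<^sup>2"
  have T: "toeplitz F = toep"
    by (simp add: fun_eq_iff toeplitz_def toep_def taylor_coeff_realization[OF F real])
  \<comment> \<open>Observability says exactly that \<open>obs\<close> is injective.\<close>
  have "obs x = 0 \<Longrightarrow> x = 0" for x
    using obsv unfolding observable_def
    by (metis (mono_tags, lifting) INT_I Rep_obs mem_Collect_eq singletonD zero_ell2.rep_eq)
  then have dense: "closure (range (adjoint_op obs)) = UNIV"
    by (rule dense_range_adjoint_op[OF bounded_clinear_obs])
  define \<phi> where "\<phi> h =
    d + ((norm (Rep_ell2 h 0 - \<delta> u))\<^sup>2 + (norm (adjoint_op obs (ell2_tl h) - \<beta> u))\<^sup>2)" for h
  have "(INF h. \<phi> h) = d"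
  proof (rule cInf_eq)
    show "d \<le> r" if "r \<in> range \<phi>" for r
      using that by (auto simp: \<phi>_def)
    fix r assume r: "\<And>s. s \<in> range \<phi> \<Longrightarrow> r \<le> s"
    show "r \<le> d"
    proof (rule field_le_epsilon)
      fix e :: real assume "0 < e"
      then have "0 < sqrt e"
        by simp
      moreover have "\<beta> u \<in> closure (range (adjoint_op obs))"
        by (simp add: dense)
      ultimately obtain g where g: "norm (adjoint_op obs g - \<beta> u) < sqrt e"
        unfolding closure_approachable dist_norm by blast
      have "(norm (adjoint_op obs g - \<beta> u))\<^sup>2 \<le> (sqrt e)\<^sup>2"
        using g by (intro power_mono) auto
      \<comment> \<open>The first entry \<open>\<delta> u\<close> cancels one square exactly; the
        tail \<open>g\<close> keeps the other at most \<open>e\<close>.\<close>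
      then have "\<phi> (ell2_cons (\<delta> u) g) \<le> d + e"
        using \<open>0 < e\<close> by (simp add: \<phi>_def ell2_cons.rep_eq)
      with r[of "\<phi> (ell2_cons (\<delta> u) g)"] show "r \<le> d + e"
        by simp
    qed
  qed
  then show ?thesis
    unfolding entropy_def T entropy_functional_eq by (simp add: \<phi>_def d_def)
qed

end

theorem lemma7p2:
  fixes F :: "complex \<Rightarrow> 'u :: complex_hilbert \<Rightarrow> 'y :: complex_hilbert"
    and \<alpha> :: "'x :: complex_hilbert \<Rightarrow> 'x" and \<beta> :: "'u \<Rightarrow> 'x"
    and \<gamma> :: "'x \<Rightarrow> 'y" and \<delta> :: "'u \<Rightarrow> 'y"
    and M :: "('u \<times> 'x) set" and u :: 'u
  assumes "F \<in> schur_class"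
    and "system_ops \<alpha> \<beta> \<gamma> \<delta>"
    and "realization \<alpha> \<beta> \<gamma> \<delta> F"
    and "co_isometric \<alpha> \<beta> \<gamma> \<delta>"
    and "observable \<alpha> \<gamma>"
    and "M = range (adjoint_op (system_matrix \<alpha> \<beta> \<gamma> \<delta>))"
  shows "complex_of_real (entropy F u) =
    cinner (orth_proj (orth_compl M) (embed_input u)) (embed_input u)"
proof -
  interpret coisometric_system \<alpha> \<beta> \<gamma> \<delta>
    by standard fact+
  have "norm (embed_input u :: 'u \<times> 'x) = norm u"
    by (simp add: embed_input_def norm_prod_def)
  \<comment> \<open>Both sides equal the squared norm of \<open>(u, 0)\<close> minus that of its
    image under the system matrix.\<close>
  then show ?thesis
    unfolding assms(6) cinner_orth_proj entropy_eq[OF assms(1,3,5)]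
    by (simp add: embed_input_def)
qed

end
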